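(* Suppose that $A\sim\mathrm{SBiSBM}(Z_1,Z_2,p,q)$ with $K=L\ge2$, $n_2\gg n_1\log n_1$, $n_1n_2p_{\max}^2/(KL)\to\infty$ and $n_1n_2p_{\max}^2/(KL)=O(\log n_1)$ as $n_1\to\infty$, where $p_{\max}=p$ and $q=cp$ for a constant $c\in(0,1)$. Then there exists a constant $c_1>0$ such that, for all $n_1$ large enough, $$\inf_{\hat z}\sup_{\theta\in\Theta}\mathbb E\big(r(\hat z,z)\big)\ge\exp\big(-c_1n_1n_2p_{\max}^2/(KL)\big),$$ where the infimum is taken over all measurable functions $\hat z$ of $A$. Moreover, if (in place of the two growth conditions on $n_1n_2p_{\max}^2/(KL)$) $n_1n_2p_{\max}^2/(KL)=\Theta(1)$, then $\inf_{\hat z}\sup_{\theta\in\Theta}\mathbb E(r(\hat z,z))\ge c_2/K^3$ for some positive constant $c_2$.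
   Context: There are $n_1$ row nodes and $n_2$ column nodes, each partitioned into $K$ communities, with membership matrices $Z_1\in\mathcal M_{n_1,K}$, $Z_2\in\mathcal M_{n_2,K}$, where $\mathcal M_{n,K}$ is the set of $n\times K$ $0/1$ matrices with exactly one 1 in each row. $z:[n_1]\to[K]$ is the partition function of $Z_1$ ($z_i=k$ iff $(Z_1)_{ik}=1$). $A\sim\mathrm{SBiSBM}(Z_1,Z_2,p,q)$ means that $A\in\{0,1\}^{n_1\times n_2}$ has independent entries $A_{ij}\sim\mathrm{Bernoulli}(P_{ij})$ with $P=Z_1\Pi Z_2^\top$ and $\Pi=(p-q)I_K+q\mathbf 1_K\mathbf 1_K^\top$, $1\ge p>q\ge0$. The parameter space $\Theta$ is the set of matrices $P=Z_1\Pi Z_2^\top\in[0,1]^{n_1\times n_2}$ with $\Pi=q\mathbf 1_K\mathbf 1_K^\top+(p-q)I_K$, $0<p<1$, $q=cp$ for a constant $c\in(0,1)$, and $Z_1\in\mathcal M_{n_1,K}$, $Z_2\in\mathcal M_{n_2,K}$ such that the row communities $\mathcal C_k$ and column communities $\mathcal C'_l$ satisfy $\frac{n_1}{\alpha K}\le|\mathcal C_k|\le\frac{\alpha n_1}{K}$ and $\frac{n_2}{\alpha K}\le|\mathcal C'_l|\le\frac{\alpha n_2}{K}$ for all $k,l\in[K]$ with $\alpha=1+O(\sqrt{\log n_1/n_1})$. Here $p$ (hence $q$) is the given sequence of edge probabilities, so the supremum is over $(Z_1,Z_2)$. Misclustering rate: $r(\hat z,z)=\frac1{n_1}\min_\pi\sum_{i\in[n_1]}\mathbf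 1_{\{\hat z(i)\ne\pi(z(i))\}}$, minimum over permutations $\pi$ of $[K]$. Notation: $a_n\gg b_n$ means $a_n/b_n\to\infty$; $a_n=O(b_n)$ means $a_n\le Cb_n$ for some constant $C>0$ and $n$ large enough; $a_n=\Theta(b_n)$ means $a_n=O(b_n)$ and $b_n=O(a_n)$. In the paper's notation, $c_1,c_2,\dots$ denote universal constants.
   Formalization: Assumes that, for large n_1, Θ is nonempty and K < n_1: if Θ is empty the supremum is undefined, and if K = n_1 all row communities are singletons, so the misclustering rate can be 0 and the bound fails; for constant K the second condition is automatic. *)

theory Defs
  imports
    "HOL-Probability.Probability"
    "HOL-Probability.Product_PMF"
    "HOL-Combinatorics.Permutations"
    "HOL-Library.Landau_Symbols"
    "Jordan_Normal_Form.Matrix"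
begin

text \<open>
  Nodes and communities are numbered from 0: row nodes are the \<open>i < n1\<close>, column nodes the
  \<open>j < n2\<close>, communities the \<open>k < K\<close>.
\<close>

definition membership_mats :: "nat \<Rightarrow> nat \<Rightarrow> real mat set" where
  "membership_mats n K =
     {Z \<in> carrier_mat n K. elements_mat Z \<subseteq> {0, 1} \<and> (\<forall>i<n. \<exists>!k. k < K \<and> Z $$ (i, k) = 1)}"

definition partition_fun :: "real mat \<Rightarrow> nat \<Rightarrow> nat" where
  "partition_fun Z i = (THE k. k < dim_col Z \<and> Z $$ (i, k) = 1)"

definition community :: "real mat \<Rightarrow> nat \<Rightarrow> nat set" where
  "community Z k = {i. i < dim_row Z \<and> Z $$ (i, k) = 1}"

definition ones_vec :: "nat \<Rightarrow> real mat" where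
  "ones_vec K = mat K 1 (\<lambda>_. 1)"

definition connectivity :: "nat \<Rightarrow> real \<Rightarrow> real \<Rightarrow> real mat" where
  "connectivity K p q =
     (p - q) \<cdot>\<^sub>m 1\<^sub>m K + q \<cdot>\<^sub>m (ones_vec K * transpose_mat (ones_vec K))"

definition prob_mat :: "nat \<Rightarrow> real mat \<Rightarrow> real mat \<Rightarrow> real \<Rightarrow> real \<Rightarrow> real mat" where
  "prob_mat K Z1 Z2 p q = Z1 * connectivity K p q * transpose_mat Z2"

text \<open>
  The law of the random 0/1 matrix \<open>A\<close>: independent Bernoulli entries, where \<open>A (i, j)\<close> is
  \<open>True\<close> for an entry 1. Entries outside the index range are constantly \<open>False\<close>.
\<close>

definition SBiSBM ::
  "nat \<Rightarrow> real mat \<Rightarrow> real mat \<Rightarrow> real \<Rightarrow> real \<Rightarrow> (nat \<times> nat \<Rightarrow> bool) pmf" where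
  "SBiSBM K Z1 Z2 p q =
     Pi_pmf ({..<dim_row Z1} \<times> {..<dim_row Z2}) False
       (\<lambda>ij. bernoulli_pmf (prob_mat K Z1 Z2 p q $$ ij))"

definition balanced :: "real \<Rightarrow> nat \<Rightarrow> nat \<Rightarrow> real mat \<Rightarrow> bool" where
  "balanced \<alpha> n K Z \<longleftrightarrow>
     (\<forall>k<K. real n / (\<alpha> * real K) \<le> real (card (community Z k)) \<and>
            real (card (community Z k)) \<le> \<alpha> * real n / real K)"

text \<open>
  For given edge probabilities a parameter \<open>prob_mat K Z1 Z2 p q\<close> is represented by the pair
  \<open>(Z1, Z2)\<close>, because the risk below refers to the partition function of \<open>Z1\<close>.
\<close>

definition param_space :: "nat \<Rightarrow> nat \<Rightarrow> nat \<Rightarrow> real \<Rightarrow> (real mat \<times> real mat) set" where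
  "param_space n1 n2 K \<alpha> =
     {(Z1, Z2). Z1 \<in> membership_mats n1 K \<and> Z2 \<in> membership_mats n2 K \<and>
                balanced \<alpha> n1 K Z1 \<and> balanced \<alpha> n2 K Z2}"

definition misclustering_rate :: "nat \<Rightarrow> nat \<Rightarrow> (nat \<Rightarrow> nat) \<Rightarrow> (nat \<Rightarrow> nat) \<Rightarrow> real" where
  "misclustering_rate n1 K zh z =
     (MIN \<pi>\<in>{\<pi>. \<pi> permutes {..<K}}. \<Sum>i<n1. of_bool (zh i \<noteq> \<pi> (z i))) / real n1"

definition estimators :: "nat \<Rightarrow> nat \<Rightarrow> ((nat \<times> nat \<Rightarrow> bool) \<Rightarrow> nat \<Rightarrow> nat) set" where
  "estimators n1 K = count_space UNIV \<rightarrow>\<^sub>M count_space ({..<n1} \<rightarrow>\<^sub>E {..<K})"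

text \<open>
  The infimum and supremum are taken in the reals. Since all values lie in the unit interval they
  are the intended ones as soon as the parameter space is nonempty.
\<close>

definition minimax_risk ::
  "nat \<Rightarrow> nat \<Rightarrow> nat \<Rightarrow> real \<Rightarrow> real \<Rightarrow> real \<Rightarrow> real" where
  "minimax_risk n1 n2 K \<alpha> p q =
     (INF zh\<in>estimators n1 K. SUP (Z1, Z2)\<in>param_space n1 n2 K \<alpha>.
        measure_pmf.expectation (SBiSBM K Z1 Z2 p q)
          (\<lambda>A. misclustering_rate n1 K (zh A) (partition_fun Z1)))"

definition snr :: "nat \<Rightarrow> nat \<Rightarrow> nat \<Rightarrow> real \<Rightarrow> real" where
  "snr n1 n2 K p = real n1 * real n2 * p\<^sup>2 / (real K * real K)"

text \<open>
  The asymptotic setting. All quantities except \<open>c\<close> are sequences over a common index, along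
  which \<open>n1\<close> tends to infinity; in particular \<open>K\<close> may be constant or vary. The last two
  conditions exclude degenerate cases only: an empty parameter space (for instance \<open>\<alpha> = 1\<close> while
  \<open>K\<close> does not divide \<open>n1\<close>), and \<open>K = n1\<close>, where nonemptiness together with \<open>\<alpha> \<longlonglongrightarrow> 1\<close> eventually
  forces all row communities to be singletons and the misclustering rate of the identity
  labelling vanishes.
\<close>

definition sbisbm_regime ::
  "real \<Rightarrow> (nat \<Rightarrow> nat) \<Rightarrow> (nat \<Rightarrow> nat) \<Rightarrow> (nat \<Rightarrow> nat) \<Rightarrow> (nat \<Rightarrow> real) \<Rightarrow> (nat \<Rightarrow> real) \<Rightarrow> bool"
  where
  "sbisbm_regime c n1 n2 K \<alpha> p \<longleftrightarrow>
     0 < c \<and> c < 1 \<and>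
     (\<forall>m. 2 \<le> K m) \<and>
     (\<forall>m. 0 < p m \<and> p m < 1) \<and>
     filterlim n1 at_top sequentially \<and>
     filterlim (\<lambda>m. real (n2 m) / (real (n1 m) * ln (real (n1 m)))) at_top sequentially \<and>
     (\<lambda>m. \<alpha> m - 1) \<in> O[sequentially](\<lambda>m. sqrt (ln (real (n1 m)) / real (n1 m))) \<and>
     (\<forall>\<^sub>F m in sequentially. param_space (n1 m) (n2 m) (K m) (\<alpha> m) \<noteq> {}) \<and>
     (\<forall>\<^sub>F m in sequentially. K m < n1 m)"

end

theory Submission
  imports Defs
begin

text \<open>
  Both parts follow from one bound at fixed sizes, \<open>minimax_risk_ge\<close>: the minimax risk is at least
  \<open>exp (- 768 * snr) / 1728\<close> as soon as \<open>2 * K \<le> n1\<close>, \<open>K \<le> n2\<close>, the parameter space is nonempty,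
  and \<open>p\<close> and \<open>n1 * p\<^sup>2 / K\<close> are below absolute constants. In the first part the factor \<open>1 / 1728\<close>
  is absorbed since \<open>snr\<close> tends to infinity; in the second part the bound is a positive constant,
  which is stronger than \<open>c\<^sub>2 / K ^ 3\<close>.

  The lower bound confronts the estimator with a random parameter. Start from the labels
  \<open>i mod K\<close>, whose classes differ in size by at most one, so that they are balanced whenever any
  labelling is. Pair the labels \<open>2 b\<close> and \<open>2 b + 1\<close>; within such a pair of labels, neighbouring
  rows may exchange their labels, and so may neighbouring columns. An exchange keeps all class
  sizes, so every set of exchanges stays in the parameter space, even if the balance condition
  leaves no freedom at all. For the rows the set of exchanges is the unknown to be recovered; for
  the columns every exchange is decided by an independent fair coin, so that the column labels
  carry information about the rows only through the data.

  Only the later half of the rows of a class takes part in exchanges. The other rows act as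
  anchors: a relabelling of the communities that does not fix both labels of a pair misplaces all
  anchors of one of them, which costs at least as much as all exchanges in that pair together.
  Hence two of the labellings differ, under any relabelling, in at least as many rows as there are
  exchanges in which they differ (\<open>hamming_le_relabelled_mismatches\<close>), and Assouad's argument
  (\<open>Assouad\<close>) reduces the risk to testing one single exchange.

  The error of such a test is controlled by the Bhattacharyya affinity of the two mixtures over
  the columns, which is a product over column pairs. In one column pair the two hypotheses are
  \<open>(F0 g0 + F1 g1) / 2\<close> and \<open>(F0 g1 + F1 g0) / 2\<close>, where \<open>g0\<close>, \<open>g1\<close> are the laws of the two
  exchanged rows and \<open>F0\<close>, \<open>F1\<close> those of all others, under both outcomes of the coin. Their
  difference is \<open>(F0 - F1) (g0 - g1) / 2\<close>: it is small to second order, because the coin hides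
  which column is which unless the other rows reveal it. This gives an affinity deficit of order
  \<open>p * (n1 p / K)\<close> per column pair (\<open>affinity_mixture_ge\<close>, \<open>affinity_block_paired\<close>); with about
  \<open>n2 / K\<close> relevant column pairs the exponent is of order \<open>n1 n2 p\<^sup>2 / K\<^sup>2 = snr\<close>, with a constant
  that does not depend on \<open>q / p\<close>. All label pairs are used simultaneously, which is why a
  constant fraction of all rows is uncertain and no factor \<open>1 / K\<close> is lost.
\<close>

section \<open>Factorization of sums over random sets\<close>

text \<open>
  A random 0/1 matrix is represented by the set \<open>X\<close> of its entries equal to 1. A condition such as
  \<open>f (X \<inter> I) = f X\<close> says that \<open>f\<close> depends only on the entries in \<open>I\<close>, so that sums over disjoint
  index sets factorize.
\<close>
lemma sum_Pow_Un:
  fixes f g :: "'a set \<Rightarrow> real"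
  assumes fin: "finite I" "finite J" and disj: "I \<inter> J = {}"
    and f: "\<And>X. f (X \<inter> I) = f X" and g: "\<And>X. g (X \<inter> J) = g X"
  shows "(\<Sum>X\<in>Pow (I \<union> J). f X * g X) = (\<Sum>X\<in>Pow I. f X) * (\<Sum>X\<in>Pow J. g X)"
proof -
  have "(\<Sum>X\<in>Pow I. f X) * (\<Sum>X\<in>Pow J. g X) = (\<Sum>(X, Y)\<in>Pow I \<times> Pow J. f X * g Y)"
    by (simp add: sum_product sum.cartesian_product)
  also have "\<dots> = (\<Sum>X\<in>Pow (I \<union> J). f X * g X)"
  proof (rule sum.reindex_bij_witness[of _ "\<lambda>X. (X \<inter> I, X \<inter> J)" "\<lambda>(X, Y). X \<union> Y"], goal_cases)
    case (5 a)
    then obtain X Y where a: "a = (X, Y)" "X \<subseteq> I" "Y \<subseteq> J" by auto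
    have "(X \<union> Y) \<inter> I = X" "(X \<union> Y) \<inter> J = Y" using a disj by auto
    then show ?case using f[of "X \<union> Y"] g[of "X \<union> Y"] a by simp
  qed (use disj in auto)
  finally show ?thesis by simp
qed

lemma sum_Pow_UN:
  fixes F :: "'b \<Rightarrow> 'a set \<Rightarrow> real"
  assumes "finite B" and "\<And>b. b \<in> B \<Longrightarrow> finite (I b)" and "disjoint_family_on I B"
    and "\<And>b X. b \<in> B \<Longrightarrow> F b (X \<inter> I b) = F b X"
  shows "(\<Sum>X\<in>Pow (\<Union>b\<in>B. I b). \<Prod>b\<in>B. F b X) = (\<Prod>b\<in>B. \<Sum>X\<in>Pow (I b). F b X)"
  using assms
proof (induction B rule: finite_induct)
  case empty
  then show ?case by simp
next
  case (insert a B)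
  have disj: "I a \<inter> (\<Union>b\<in>B. I b) = {}"
    using insert.prems(2) insert.hyps(2) by (fastforce simp: disjoint_family_on_def)
  have "(\<Prod>b\<in>B. F b (X \<inter> (\<Union>b\<in>B. I b))) = (\<Prod>b\<in>B. F b X)" for X
  proof (rule prod.cong[OF refl])
    fix b assume b: "b \<in> B"
    have "X \<inter> (\<Union>b\<in>B. I b) \<inter> I b = X \<inter> I b" using b by auto
    then show "F b (X \<inter> (\<Union>b\<in>B. I b)) = F b X"
      using insert.prems(3)[of b] b by (metis insertI2)
  qed
  then have "(\<Sum>X\<in>Pow (I a \<union> (\<Union>b\<in>B. I b)). F a X * (\<Prod>b\<in>B. F b X))
      = (\<Sum>X\<in>Pow (I a). F a X) * (\<Sum>X\<in>Pow (\<Union>b\<in>B. I b). \<Prod>b\<in>B. F b X)"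
    using disj insert.prems insert.hyps by (intro sum_Pow_Un) auto
  moreover have "(\<Sum>X\<in>Pow (\<Union>b\<in>B. I b). \<Prod>b\<in>B. F b X) = (\<Prod>b\<in>B. \<Sum>X\<in>Pow (I b). F b X)"
    using insert.prems by (intro insert.IH) (auto simp: disjoint_family_on_def)
  ultimately show ?case using insert.hyps by simp
qed

section \<open>Affinity of Bernoulli products and of their mixtures\<close>

text \<open>
  The Bhattacharyya coefficient of two laws on the subsets of \<open>I\<close>. Unlike the total variation
  distance it is multiplicative over independent blocks, mixtures within the blocks included.
\<close>
definition affinity :: "'a set \<Rightarrow> ('a set \<Rightarrow> real) \<Rightarrow> ('a set \<Rightarrow> real) \<Rightarrow> real" where
  "affinity I P Q = (\<Sum>X\<in>Pow I. sqrt (P X * Q X))"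

lemma sqrt_prod: "sqrt (\<Prod>b\<in>B. f b) = (\<Prod>b\<in>B. sqrt (f b))"
  by (induction B rule: infinite_finite_induct) (auto simp: real_sqrt_mult)

lemma affinity_UN:
  assumes "finite B" and "\<And>b. b \<in> B \<Longrightarrow> finite (I b)" and "disjoint_family_on I B"
    and "\<And>b X. b \<in> B \<Longrightarrow> P b (X \<inter> I b) = P b X" and "\<And>b X. b \<in> B \<Longrightarrow> Q b (X \<inter> I b) = Q b X"
  shows "affinity (\<Union>b\<in>B. I b) (\<lambda>X. \<Prod>b\<in>B. P b X) (\<lambda>X. \<Prod>b\<in>B. Q b X)
    = (\<Prod>b\<in>B. affinity (I b) (P b) (Q b))"
  unfolding affinity_def
  by (subst sum_Pow_UN[symmetric]) (use assms in \<open>auto simp: sqrt_prod prod.distrib[symmetric]\<close>)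

definition bernoulli_weight :: "('a \<Rightarrow> real) \<Rightarrow> 'a set \<Rightarrow> 'a set \<Rightarrow> real" where
  "bernoulli_weight M I X = (\<Prod>e\<in>I. if e \<in> X then M e else 1 - M e)"

lemma bernoulli_weight_Int: "bernoulli_weight M I (X \<inter> I) = bernoulli_weight M I X"
  unfolding bernoulli_weight_def by (rule prod.cong) auto

lemma bernoulli_weight_cong:
  "(\<And>e. e \<in> I \<Longrightarrow> M e = N e) \<Longrightarrow> bernoulli_weight M I X = bernoulli_weight N I X"
  unfolding bernoulli_weight_def by (rule prod.cong) auto

lemma bernoulli_weight_nonneg:
  "(\<And>e. e \<in> I \<Longrightarrow> 0 \<le> M e \<and> M e \<le> 1) \<Longrightarrow> 0 \<le> bernoulli_weight M I X"
  unfolding bernoulli_weight_def by (rule prod_nonneg) auto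

lemma bernoulli_weight_Un:
  "finite I \<Longrightarrow> finite J \<Longrightarrow> I \<inter> J = {} \<Longrightarrow>
    bernoulli_weight M (I \<union> J) X = bernoulli_weight M I X * bernoulli_weight M J X"
  unfolding bernoulli_weight_def by (rule prod.union_disjoint)

lemma bernoulli_weight_UN:
  "finite B \<Longrightarrow> (\<And>b. b \<in> B \<Longrightarrow> finite (I b)) \<Longrightarrow> disjoint_family_on I B \<Longrightarrow>
    bernoulli_weight M (\<Union>b\<in>B. I b) X = (\<Prod>b\<in>B. bernoulli_weight M (I b) X)"
  unfolding bernoulli_weight_def by (rule prod.UNION_disjoint) (auto simp: disjoint_family_on_def)

lemma Pow_singleton: "Pow {e} = {{}, {e}}"
  by auto

lemma sum_bernoulli_weight:
  assumes "finite I"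
  shows "(\<Sum>X\<in>Pow I. bernoulli_weight M I X) = 1"
proof -
  have "(\<Sum>X\<in>Pow (\<Union>e\<in>I. {e}). \<Prod>e\<in>I. if e \<in> X then M e else 1 - M e)
      = (\<Prod>e\<in>I. \<Sum>X\<in>Pow {e}. if e \<in> X then M e else 1 - M e)"
    using assms by (intro sum_Pow_UN) (auto simp: disjoint_family_on_def)
  also have "\<dots> = 1" by (simp add: Pow_singleton)
  finally show ?thesis by (simp add: bernoulli_weight_def)
qed

lemma affinity_bernoulli_weight:
  assumes "finite I"
  shows "affinity I (bernoulli_weight M I) (bernoulli_weight N I)
    = (\<Prod>e\<in>I. sqrt (M e * N e) + sqrt ((1 - M e) * (1 - N e)))"
proof -
  let ?w = "\<lambda>M e X. if e \<in> X then M e else 1 - M e :: real"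
  have "affinity (\<Union>e\<in>I. {e}) (\<lambda>X. \<Prod>e\<in>I. ?w M e X) (\<lambda>X. \<Prod>e\<in>I. ?w N e X)
      = (\<Prod>e\<in>I. affinity {e} (?w M e) (?w N e))"
    using assms by (intro affinity_UN) (auto simp: disjoint_family_on_def)
  also have "\<dots> = (\<Prod>e\<in>I. sqrt (M e * N e) + sqrt ((1 - M e) * (1 - N e)))"
    by (rule prod.cong) (auto simp: affinity_def Pow_singleton)
  finally show ?thesis by (simp add: bernoulli_weight_def[abs_def])
qed

text \<open>
  Where the two success probabilities differ, the outcome 0 alone contributes at least \<open>1 - p\<close> to
  the affinity of that entry. Bounding the deficit by the larger probability rather than by a
  distance of the two makes all later bounds independent of the ratio of the edge probabilities.
\<close>
lemma affinity_bernoulli_weight_ge: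
  assumes fin: "finite I" and E: "E \<subseteq> I" and p: "p \<le> 1"
    and M: "\<And>e. e \<in> I \<Longrightarrow> 0 \<le> M e \<and> M e \<le> p" and N: "\<And>e. e \<in> I \<Longrightarrow> 0 \<le> N e \<and> N e \<le> p"
    and eq: "\<And>e. e \<in> I - E \<Longrightarrow> M e = N e"
  shows "(1 - p) ^ card E \<le> affinity I (bernoulli_weight M I) (bernoulli_weight N I)"
proof -
  let ?bc = "\<lambda>e. sqrt (M e * N e) + sqrt ((1 - M e) * (1 - N e))"
  have "?bc e \<ge> 1 - p" if "e \<in> I" for e
  proof -
    have "(1 - p)\<^sup>2 \<le> (1 - M e) * (1 - N e)"
      unfolding power2_eq_square using M[OF that] N[OF that] p by (intro mult_mono) auto
    then have "1 - p \<le> sqrt ((1 - M e) * (1 - N e))"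
      by (rule real_le_rsqrt)
    moreover have "0 \<le> sqrt (M e * N e)" using M[OF that] N[OF that] by simp
    ultimately show ?thesis by linarith
  qed
  then have "(\<Prod>e\<in>E. 1 - p) \<le> (\<Prod>e\<in>E. ?bc e)"
    using p E by (intro prod_mono) auto
  moreover have "(\<Prod>e\<in>I - E. ?bc e) = 1"
  proof (rule prod.neutral, rule ballI)
    fix e assume e: "e \<in> I - E"
    then show "?bc e = 1" using eq[OF e] M[of e] p by simp
  qed
  moreover have "(\<Prod>e\<in>I. ?bc e) = (\<Prod>e\<in>I - E. ?bc e) * (\<Prod>e\<in>E. ?bc e)"
    by (rule prod.subset_diff[OF E fin])
  ultimately show ?thesis using fin by (simp add: affinity_bernoulli_weight)
qed

text \<open>
  The triangular discrimination \<open>(a - b)\<^sup>2 / (a + b)\<close> lies between \<open>(sqrt a - sqrt b)\<^sup>2\<close> and twice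
  that square. Both directions are needed in order to pass from affinities to triangular
  discriminations and back. For \<open>a = b = 0\<close> the quotient is 0 by the convention for division.
\<close>
lemma sqrt_ge_triangular_discrimination:
  fixes a b :: real
  assumes "0 \<le> a" "0 \<le> b"
  shows "(a + b) / 2 - (a - b)\<^sup>2 / (a + b) / 2 \<le> sqrt (a * b)"
    and "(a - b)\<^sup>2 / (a + b) \<le> 2 * (a + b) - 4 * sqrt (a * b)"
proof -
  define x y where "x = sqrt a" and "y = sqrt b"
  have ab: "a = x\<^sup>2" "b = y\<^sup>2" and xy: "0 \<le> x" "0 \<le> y" "sqrt (a * b) = x * y"
    using assms by (auto simp: x_def y_def real_sqrt_mult)
  have "(a - b)\<^sup>2 / (a + b) = (x - y)\<^sup>2 * ((x + y)\<^sup>2 / (x\<^sup>2 + y\<^sup>2))"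
    unfolding ab by (simp add: power2_eq_square algebra_simps)
  moreover have "(x + y)\<^sup>2 / (x\<^sup>2 + y\<^sup>2) \<le> 2"
  proof (cases "x\<^sup>2 + y\<^sup>2 = 0")
    case False
    then have "0 < x\<^sup>2 + y\<^sup>2" by (simp add: sum_power2_gt_zero_iff)
    moreover have "(x + y)\<^sup>2 \<le> 2 * (x\<^sup>2 + y\<^sup>2)"
      using zero_le_power2[of "x - y"] by (simp add: power2_eq_square algebra_simps)
    ultimately show ?thesis by (simp add: divide_le_eq)
  qed (simp only: div_by_0 zero_le_numeral)
  moreover have "(x - y)\<^sup>2 * 1 \<le> (x - y)\<^sup>2 * ((x + y)\<^sup>2 / (x\<^sup>2 + y\<^sup>2))"
  proof (cases "x\<^sup>2 + y\<^sup>2 = 0")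
    case False
    then have "0 < x\<^sup>2 + y\<^sup>2" by (simp add: sum_power2_gt_zero_iff)
    moreover have "x\<^sup>2 + y\<^sup>2 \<le> (x + y)\<^sup>2"
      using xy by (simp add: power2_eq_square algebra_simps)
    ultimately have "1 \<le> (x + y)\<^sup>2 / (x\<^sup>2 + y\<^sup>2)" by simp
    then show ?thesis by (intro mult_left_mono) auto
  qed simp
  ultimately have lo: "(x - y)\<^sup>2 \<le> (a - b)\<^sup>2 / (a + b)" and hi: "(a - b)\<^sup>2 / (a + b) \<le> (x - y)\<^sup>2 * 2"
    using mult_left_mono[of "(x + y)\<^sup>2 / (x\<^sup>2 + y\<^sup>2)" 2 "(x - y)\<^sup>2"] by auto
  have "(x - y)\<^sup>2 = x\<^sup>2 + y\<^sup>2 - 2 * (x * y)"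
    by (simp add: power2_eq_square algebra_simps)
  then have sq: "(x - y)\<^sup>2 = a + b - 2 * sqrt (a * b)"
    using xy(3) ab by linarith
  define d where "d = (a - b)\<^sup>2 / (a + b)"
  show "(a + b) / 2 - (a - b)\<^sup>2 / (a + b) / 2 \<le> sqrt (a * b)"
    using lo unfolding sq d_def[symmetric] by (simp add: field_simps)
  show "(a - b)\<^sup>2 / (a + b) \<le> 2 * (a + b) - 4 * sqrt (a * b)"
    using hi unfolding sq d_def[symmetric] by (simp add: field_simps)
qed

text \<open>
  With \<open>P\<close> and \<open>Q\<close> the two mixtures, \<open>P - Q = (F0 - F1) (g0 - g1) / 2\<close> and
  \<open>P + Q = (F0 + F1) (g0 + g1) / 2\<close>. Hence the triangular discrimination of \<open>P\<close> and \<open>Q\<close> is exactly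
  half of the product of those of \<open>F0, F1\<close> and of \<open>g0, g1\<close>: one cannot tell the hypotheses apart
  unless both the component \<open>F\<close> reveals the hidden coin and the component \<open>g\<close> is informative given
  the coin.
\<close>
lemma affinity_mixture_ge:
  fixes F0 F1 g0 g1 :: "'a set \<Rightarrow> real"
  assumes fin: "finite R" "finite G" and disj: "R \<inter> G = {}"
    and nonneg: "\<And>X. 0 \<le> F0 X" "\<And>X. 0 \<le> F1 X" "\<And>X. 0 \<le> g0 X" "\<And>X. 0 \<le> g1 X"
    and loc: "\<And>X. F0 (X \<inter> R) = F0 X" "\<And>X. F1 (X \<inter> R) = F1 X"
      "\<And>X. g0 (X \<inter> G) = g0 X" "\<And>X. g1 (X \<inter> G) = g1 X"
    and sum1: "(\<Sum>X\<in>Pow R. F0 X) = 1" "(\<Sum>X\<in>Pow R. F1 X) = 1"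
      "(\<Sum>X\<in>Pow G. g0 X) = 1" "(\<Sum>X\<in>Pow G. g1 X) = 1"
  shows "1 - 4 * (1 - affinity R F0 F1) * (1 - affinity G g0 g1)
    \<le> affinity (R \<union> G) (\<lambda>X. (F0 X * g0 X + F1 X * g1 X) / 2) (\<lambda>X. (F0 X * g1 X + F1 X * g0 X) / 2)"
proof -
  define dF where "dF X = (F0 X - F1 X)\<^sup>2 / (F0 X + F1 X)" for X
  define dg where "dg X = (g0 X - g1 X)\<^sup>2 / (g0 X + g1 X)" for X
  let ?P = "\<lambda>X. (F0 X * g0 X + F1 X * g1 X) / 2" and ?Q = "\<lambda>X. (F0 X * g1 X + F1 X * g0 X) / 2"
  have factor: "(\<Sum>X\<in>Pow (R \<union> G). f X * g X) = (\<Sum>X\<in>Pow R. f X) * (\<Sum>X\<in>Pow G. g X)"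
    if "\<And>X. f (X \<inter> R) = f X" "\<And>X. g (X \<inter> G) = g X" for f g :: "'a set \<Rightarrow> real"
    using fin disj that by (rule sum_Pow_Un)
  have sumF: "(\<Sum>X\<in>Pow R. dF X) \<le> 4 * (1 - affinity R F0 F1)"
  proof -
    have "(\<Sum>X\<in>Pow R. dF X) \<le> (\<Sum>X\<in>Pow R. 2 * (F0 X + F1 X) - 4 * sqrt (F0 X * F1 X))"
      unfolding dF_def by (intro sum_mono sqrt_ge_triangular_discrimination nonneg)
    then show ?thesis
      by (simp add: sum_subtractf sum.distrib sum_distrib_left[symmetric] sum1 affinity_def)
  qed
  have sumg: "(\<Sum>X\<in>Pow G. dg X) \<le> 4 * (1 - affinity G g0 g1)"
  proof -
    have "(\<Sum>X\<in>Pow G. dg X) \<le> (\<Sum>X\<in>Pow G. 2 * (g0 X + g1 X) - 4 * sqrt (g0 X * g1 X))"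
      unfolding dg_def by (intro sum_mono sqrt_ge_triangular_discrimination nonneg)
    then show ?thesis
      by (simp add: sum_subtractf sum.distrib sum_distrib_left[symmetric] sum1 affinity_def)
  qed
  have pointwise: "(F0 X * g0 X + F1 X * g1 X + F0 X * g1 X + F1 X * g0 X) / 4 - dF X * dg X / 4
      \<le> sqrt (?P X * ?Q X)" for X
  proof -
    have sub: "?P X - ?Q X = (F0 X - F1 X) * (g0 X - g1 X) / 2"
      and add: "?P X + ?Q X = (F0 X + F1 X) * (g0 X + g1 X) / 2"
      by (auto simp: field_simps)
    have eq: "(?P X - ?Q X)\<^sup>2 / (?P X + ?Q X) = dF X * dg X / 2"
      unfolding sub add dF_def dg_def by (simp add: power2_eq_square mult_ac)
    have mean: "(?P X + ?Q X) / 2 = (F0 X * g0 X + F1 X * g1 X + F0 X * g1 X + F1 X * g0 X) / 4"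
      by (simp add: field_simps)
    have "(?P X + ?Q X) / 2 - (?P X - ?Q X)\<^sup>2 / (?P X + ?Q X) / 2 \<le> sqrt (?P X * ?Q X)"
      by (intro sqrt_ge_triangular_discrimination) (auto simp: nonneg)
    then show ?thesis unfolding eq mean by simp
  qed
  have loc_d: "dF (X \<inter> R) = dF X" "dg (X \<inter> G) = dg X" for X
    by (auto simp: dF_def dg_def loc)
  have "(\<Sum>X\<in>Pow (R \<union> G). (F0 X * g0 X + F1 X * g1 X + F0 X * g1 X + F1 X * g0 X) / 4 - dF X * dg X / 4)
      \<le> affinity (R \<union> G) ?P ?Q"
    unfolding affinity_def by (intro sum_mono pointwise)
  also have "(\<Sum>X\<in>Pow (R \<union> G). (F0 X * g0 X + F1 X * g1 X + F0 X * g1 X + F1 X * g0 X) / 4 - dF X * dg X / 4)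
      = 1 - (\<Sum>X\<in>Pow R. dF X) * (\<Sum>X\<in>Pow G. dg X) / 4"
    by (simp add: sum_subtractf sum.distrib sum_divide_distrib[symmetric] factor loc sum1 loc_d)
  finally have "1 - (\<Sum>X\<in>Pow R. dF X) * (\<Sum>X\<in>Pow G. dg X) / 4 \<le> affinity (R \<union> G) ?P ?Q" .
  moreover have "(\<Sum>X\<in>Pow R. dF X) * (\<Sum>X\<in>Pow G. dg X)
      \<le> (4 * (1 - affinity R F0 F1)) * (4 * (1 - affinity G g0 g1))"
  proof (rule mult_mono)
    have "0 \<le> (\<Sum>X\<in>Pow R. dF X)" unfolding dF_def by (intro sum_nonneg) (simp add: nonneg)
    then show "0 \<le> 4 * (1 - affinity R F0 F1)" using sumF by linarith
    show "0 \<le> (\<Sum>X\<in>Pow G. dg X)" unfolding dg_def by (intro sum_nonneg) (simp add: nonneg)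
  qed (fact sumF sumg)+
  ultimately show ?thesis by linarith
qed

section \<open>From affinity to risk\<close>

text \<open>
  Le Cam's inequality: \<open>P Q = min P Q * max P Q\<close>, so Cauchy-Schwarz bounds the squared affinity by
  the testing error (the mass of the minimum) times the mass of the maximum, which is at most 2.
\<close>
lemma sum_min_ge_affinity:
  assumes "finite I" and nonneg: "\<And>X. 0 \<le> P X" "\<And>X. 0 \<le> Q X"
    and sum1: "(\<Sum>X\<in>Pow I. P X) = 1" "(\<Sum>X\<in>Pow I. Q X) = 1"
  shows "(affinity I P Q)\<^sup>2 / 2 \<le> (\<Sum>X\<in>Pow I. min (P X) (Q X))"
proof -
  let ?m = "\<lambda>X. min (P X) (Q X)" and ?M = "\<lambda>X. max (P X) (Q X)"
  have "P X * Q X = ?m X * ?M X" for X by (auto simp: min_def max_def)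
  then have "(affinity I P Q)\<^sup>2 = (\<Sum>X\<in>Pow I. sqrt (?m X) * sqrt (?M X))\<^sup>2"
    unfolding affinity_def by (simp add: real_sqrt_mult)
  also have "\<dots> \<le> (\<Sum>X\<in>Pow I. (sqrt (?m X))\<^sup>2) * (\<Sum>X\<in>Pow I. (sqrt (?M X))\<^sup>2)"
    by (rule Cauchy_Schwarz_ineq_sum)
  also have "\<dots> = (\<Sum>X\<in>Pow I. ?m X) * (\<Sum>X\<in>Pow I. ?M X)"
    using nonneg by (simp add: le_max_iff_disj)
  also have "\<dots> \<le> (\<Sum>X\<in>Pow I. ?m X) * (\<Sum>X\<in>Pow I. P X + Q X)"
    by (intro mult_left_mono sum_mono sum_nonneg) (use nonneg in \<open>auto simp: max_def\<close>)
  also have "\<dots> = (\<Sum>X\<in>Pow I. ?m X) * 2" by (simp add: sum.distrib sum1)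
  finally show ?thesis by simp
qed

text \<open>
  The loss need not be a sum over coordinates; it is only required that one observation cannot be
  close to two parameters that are far apart in Hamming distance. A minimizer of the loss then
  plays the role of an estimator \<open>h X\<close> of the parameter, and its Hamming error is at most twice
  the loss. Averaging over all parameters, each coordinate of \<open>h X\<close> has to solve a test between
  two neighbours.
\<close>
lemma Assouad:
  fixes P :: "'t set \<Rightarrow> 'x \<Rightarrow> real" and loss :: "'t set \<Rightarrow> 'x \<Rightarrow> real"
  assumes T: "finite T" and \<Omega>: "finite \<Omega>"
    and P: "\<And>S X. S \<subseteq> T \<Longrightarrow> X \<in> \<Omega> \<Longrightarrow> 0 \<le> P S X"
    and loss: "\<And>S S' X. S \<subseteq> T \<Longrightarrow> S' \<subseteq> T \<Longrightarrow> X \<in> \<Omega> \<Longrightarrow>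
      real (card (sym_diff S S')) \<le> loss S X + loss S' X"
    and test: "\<And>t S. t \<in> T \<Longrightarrow> S \<subseteq> T - {t} \<Longrightarrow>
      \<tau> \<le> (\<Sum>X\<in>\<Omega>. min (P S X) (P (insert t S) X))"
  shows "\<exists>S\<subseteq>T. real (card T) * \<tau> / 4 \<le> (\<Sum>X\<in>\<Omega>. P S X * loss S X)"
proof -
  define h where "h X = (ARG_MIN (\<lambda>S. loss S X) S. S \<in> Pow T)" for X
  have h: "h X \<subseteq> T \<and> (\<forall>S\<subseteq>T. loss (h X) X \<le> loss S X)" for X
  proof -
    have "is_arg_min (\<lambda>S. loss S X) (\<lambda>S. S \<in> Pow T) (h X)"
      unfolding h_def arg_min_def
      by (rule someI_ex) (use T ex_is_arg_min_if_finite[of "Pow T" "\<lambda>S. loss S X"] in auto)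
    then show ?thesis unfolding is_arg_min_linorder by auto
  qed
  define err where "err t S X = (of_bool ((t \<in> h X) \<noteq> (t \<in> S)) :: real)" for t S X
  have hamming: "(\<Sum>t\<in>T. err t S X) \<le> 2 * loss S X" if "S \<subseteq> T" "X \<in> \<Omega>" for S X
  proof -
    have "(\<Sum>t\<in>T. err t S X) = real (card {t \<in> T. (t \<in> h X) \<noteq> (t \<in> S)})"
      unfolding err_def using T by (simp add: of_bool_def sum.If_cases Int_def)
    also have "{t \<in> T. (t \<in> h X) \<noteq> (t \<in> S)} = sym_diff (h X) S"
      using h[of X] that by auto
    also have "real (card (sym_diff (h X) S)) \<le> loss (h X) X + loss S X"
      using h[of X] that by (intro loss) auto
    also have "\<dots> \<le> 2 * loss S X" using h[of X] that by auto
    finally show ?thesis .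
  qed
  have bit: "2 ^ card T * \<tau> / 2 \<le> (\<Sum>S\<in>Pow T. \<Sum>X\<in>\<Omega>. P S X * err t S X)" if t: "t \<in> T" for t
  proof -
    let ?T = "T - {t}" and ?f = "\<lambda>S. \<Sum>X\<in>\<Omega>. P S X * err t S X"
    have Pow: "Pow T = Pow ?T \<union> insert t ` Pow ?T"
      using t by (metis Pow_insert insert_Diff)
    have inj: "inj_on (insert t) (Pow ?T)" by (auto simp: inj_on_def)
    have "(\<Sum>S\<in>Pow T. ?f S) = (\<Sum>S\<in>Pow ?T. ?f S) + (\<Sum>S\<in>insert t ` Pow ?T. ?f S)"
      unfolding Pow using T by (intro sum.union_disjoint) auto
    also have "(\<Sum>S\<in>insert t ` Pow ?T. ?f S) = (\<Sum>S\<in>Pow ?T. ?f (insert t S))"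
      using inj by (simp add: sum.reindex)
    also have "(\<Sum>S\<in>Pow ?T. ?f S) + (\<Sum>S\<in>Pow ?T. ?f (insert t S))
        = (\<Sum>S\<in>Pow ?T. ?f S + ?f (insert t S))"
      by (simp add: sum.distrib)
    finally have eq: "(\<Sum>S\<in>Pow T. ?f S) = (\<Sum>S\<in>Pow ?T. ?f S + ?f (insert t S))" .
    have "\<tau> \<le> ?f S + ?f (insert t S)" if S: "S \<in> Pow ?T" for S
    proof -
      have "\<tau> \<le> (\<Sum>X\<in>\<Omega>. min (P S X) (P (insert t S) X))" using test t S by auto
      also have "\<dots> \<le> (\<Sum>X\<in>\<Omega>. P S X * err t S X + P (insert t S) X * err t (insert t S) X)"
        by (rule sum_mono) (use S in \<open>auto simp: err_def\<close>)
      finally show ?thesis by (simp add: sum.distrib)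
    qed
    then have "(\<Sum>S\<in>Pow ?T. \<tau>) \<le> (\<Sum>S\<in>Pow T. ?f S)" unfolding eq by (rule sum_mono)
    moreover have "(\<Sum>S\<in>Pow ?T. \<tau>) = 2 ^ card T * \<tau> / 2"
    proof -
      have "card T = Suc (card ?T)" using t T by (metis card.remove)
      then show ?thesis using T by (simp add: card_Pow)
    qed
    ultimately show ?thesis by linarith
  qed
  have "real (card T) * (2 ^ card T * \<tau> / 2) = (\<Sum>t\<in>T. 2 ^ card T * \<tau> / 2)" by simp
  also have "\<dots> \<le> (\<Sum>t\<in>T. \<Sum>S\<in>Pow T. \<Sum>X\<in>\<Omega>. P S X * err t S X)"
    by (rule sum_mono) (rule bit)
  also have "\<dots> = (\<Sum>S\<in>Pow T. \<Sum>X\<in>\<Omega>. P S X * (\<Sum>t\<in>T. err t S X))"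
    by (simp add: sum.swap[of _ _ T] sum_distrib_left)
  also have "\<dots> \<le> (\<Sum>S\<in>Pow T. \<Sum>X\<in>\<Omega>. P S X * (2 * loss S X))"
    by (intro sum_mono mult_left_mono hamming P) auto
  also have "\<dots> = 2 * (\<Sum>S\<in>Pow T. \<Sum>X\<in>\<Omega>. P S X * loss S X)"
    by (simp add: sum_distrib_left algebra_simps)
  finally have total: "2 ^ card T * (real (card T) * \<tau> / 4) \<le> (\<Sum>S\<in>Pow T. \<Sum>X\<in>\<Omega>. P S X * loss S X)"
    by (simp add: field_simps)
  show ?thesis
  proof (rule ccontr)
    assume "\<not> ?thesis"
    then have "(\<Sum>S\<in>Pow T. \<Sum>X\<in>\<Omega>. P S X * loss S X) < (\<Sum>S\<in>Pow T. real (card T) * \<tau> / 4)"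
      using T by (intro sum_strict_mono) auto
    then show False using total T by (simp add: card_Pow)
  qed
qed

section \<open>Labellings obtained by exchanging neighbours\<close>

text \<open>
  The positions \<open>i\<close> that may exchange labels with \<open>i + 1\<close>. Since residues modulo \<open>K\<close> of such
  positions are even and not the last one, different exchanges never overlap and the labels \<open>2 b\<close>,
  \<open>2 b + 1\<close> are only exchanged among themselves.
\<close>
definition paired :: "nat \<Rightarrow> nat \<Rightarrow> nat set" where
  "paired K n = {i. Suc i < n \<and> even (i mod K) \<and> Suc (i mod K) < K}"

definition swap_adjacent :: "nat set \<Rightarrow> nat \<Rightarrow> nat" where
  "swap_adjacent S i = (if i \<in> S then Suc i else if i \<in> Suc ` S then i - 1 else i)"

definition label :: "nat \<Rightarrow> nat set \<Rightarrow> nat \<Rightarrow> nat" where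
  "label K S i = swap_adjacent S i mod K"

lemma Suc_mod_paired: "i \<in> paired K n \<Longrightarrow> Suc i mod K = Suc (i mod K)"
  by (auto simp: paired_def mod_Suc)

lemma Suc_notin_paired: "i \<in> paired K n \<Longrightarrow> Suc i \<notin> paired K n"
  by (auto simp: paired_def mod_Suc)

lemma label_simps:
  assumes "S \<subseteq> paired K n"
  shows "i \<in> S \<Longrightarrow> label K S i = Suc (i mod K)"
    and "i \<in> S \<Longrightarrow> label K S (Suc i) = i mod K"
    and "i \<notin> S \<Longrightarrow> i \<notin> Suc ` S \<Longrightarrow> label K S i = i mod K"
proof -
  show "i \<in> S \<Longrightarrow> label K S i = Suc (i mod K)"
    using assms Suc_mod_paired[of i K n] by (auto simp: label_def swap_adjacent_def)
  show "i \<in> S \<Longrightarrow> label K S (Suc i) = i mod K"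
    using assms Suc_notin_paired[of i K n] by (auto simp: label_def swap_adjacent_def)
qed (simp add: label_def swap_adjacent_def)

lemma label_div_2:
  assumes "S \<subseteq> paired K n"
  shows "label K S i div 2 = i mod K div 2"
proof -
  consider "i \<in> S" | j where "j \<in> S" "i = Suc j" | "i \<notin> S" "i \<notin> Suc ` S" by auto
  then show ?thesis
  proof cases
    case 1
    then have "even (i mod K)" using assms by (auto simp: paired_def)
    then show ?thesis using label_simps(1)[OF assms 1] by simp
  next
    case 2
    then have "even (j mod K)" "Suc j mod K = Suc (j mod K)"
      using assms Suc_mod_paired[of j K n] by (auto simp: paired_def)
    then show ?thesis using label_simps(2)[OF assms 2(1)] 2 by simp
  qed (simp add: label_simps[OF assms])
qed

lemma label_less: "0 < K \<Longrightarrow> label K S i < K"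
  by (simp add: label_def)

lemma label_cong:
  assumes "i \<in> S \<longleftrightarrow> i \<in> S'" and "i \<in> Suc ` S \<longleftrightarrow> i \<in> Suc ` S'"
  shows "label K S i = label K S' i"
  using assms by (simp add: label_def swap_adjacent_def)

lemma swap_adjacent_involution:
  assumes "S \<subseteq> paired K n"
  shows "swap_adjacent S (swap_adjacent S i) = i"
  using assms Suc_notin_paired[of _ K n] by (auto simp: swap_adjacent_def subset_iff)

lemma swap_adjacent_less:
  assumes "S \<subseteq> paired K n" and "i < n"
  shows "swap_adjacent S i < n"
  using assms by (auto simp: swap_adjacent_def paired_def)

lemma card_label_class:
  assumes "S \<subseteq> paired K n"
  shows "card {i. i < n \<and> label K S i = k} = card {i. i < n \<and> i mod K = k}"
proof (rule bij_betw_same_card[of "swap_adjacent S"],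
    rule bij_betwI[where g = "swap_adjacent S"])
qed (auto simp: label_def swap_adjacent_involution[OF assms] swap_adjacent_less[OF assms])

text \<open>
  The sizes of the residue classes are those of the most even partition of \<open>n\<close> into \<open>K\<close> parts.
\<close>
lemma card_residue_class:
  assumes k: "k < K"
  shows "n div K \<le> card {i. i < n \<and> i mod K = k}" and "card {i. i < n \<and> i mod K = k} \<le> Suc (n div K)"
    and "K dvd n \<Longrightarrow> card {i. i < n \<and> i mod K = k} = n div K"
proof -
  let ?f = "\<lambda>t. t * K + k" and ?C = "{i. i < n \<and> i mod K = k}"
  have inj: "inj_on ?f A" for A using k by (auto simp: inj_on_def)
  have "?f t < n" if "t < n div K" for t
  proof -
    have "Suc t * K \<le> n div K * K" using that by (intro mult_le_mono1) auto
    also have "\<dots> \<le> n" by simp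
    finally show ?thesis using k by simp
  qed
  then have "?f ` {..<n div K} \<subseteq> ?C" using k by auto
  then have "card (?f ` {..<n div K}) \<le> card ?C" by (intro card_mono) auto
  then show lo: "n div K \<le> card ?C" by (simp add: card_image inj)
  have "?C \<subseteq> ?f ` {..n div K}"
  proof
    fix i assume "i \<in> ?C"
    then have "i = ?f (i div K)" "i div K \<le> n div K" by (auto simp: div_le_mono)
    then show "i \<in> ?f ` {..n div K}" by blast
  qed
  then have "card ?C \<le> card (?f ` {..n div K})" by (intro card_mono) auto
  then show "card ?C \<le> Suc (n div K)" by (simp add: card_image inj)
  show "card ?C = n div K" if "K dvd n"
  proof -
    have "?C \<subseteq> ?f ` {..<n div K}"
    proof
      fix i assume "i \<in> ?C"
      then have "i = ?f (i div K)" "i div K < n div K"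
        using that by (auto elim!: dvdE simp: less_mult_imp_div_less mult.commute)
      then show "i \<in> ?f ` {..<n div K}" by blast
    qed
    then have "card ?C \<le> card (?f ` {..<n div K})" by (intro card_mono) auto
    then show ?thesis using lo by (simp add: card_image inj)
  qed
qed

section \<open>Exchanges cannot be undone by relabelling communities\<close>

text \<open>
  The rows whose label is in question. The block number \<open>i div K\<close> ranges over the later half of
  the complete blocks; the rows of the earlier blocks are the anchors. The rounding is such that
  the anchors of a class are at least as many as the free rows with the same even label.
\<close>
definition free_rows :: "nat \<Rightarrow> nat \<Rightarrow> nat set" where
  "free_rows K n = {i. even (i mod K) \<and> Suc (i mod K) < K \<and>
     n div K - n div K div 2 \<le> i div K \<and> i div K < n div K}"

lemma free_rows_subset: "free_rows K n \<subseteq> paired K n"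
proof
  fix i assume i: "i \<in> free_rows K n"
  then have "Suc (i mod K) < K" "Suc (i div K) \<le> n div K" by (auto simp: free_rows_def)
  have "Suc i = i div K * K + Suc (i mod K)" by simp
  also have "\<dots> < Suc (i div K) * K" using \<open>Suc (i mod K) < K\<close> unfolding mult_Suc by linarith
  also have "\<dots> \<le> n div K * K" by (intro mult_le_mono1) fact
  also have "\<dots> \<le> n" by simp
  finally show "i \<in> paired K n" using i by (auto simp: free_rows_def paired_def)
qed

lemma finite_paired: "finite (paired K n)"
  by (rule finite_subset[of _ "{..<n}"]) (auto simp: paired_def)

lemma card_free_rows: "(n div K div 2) * (K div 2) \<le> card (free_rows K n)"
proof -
  let ?s = "n div K"
  let ?D = "{?s - ?s div 2..<?s} \<times> {..<K div 2}" and ?f = "\<lambda>(t, b). t * K + 2 * b"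
  have K: "2 * b < K" "Suc (2 * b) < K" if "b < K div 2" for b using that by auto
  have "inj_on ?f ?D"
  proof (rule inj_onI, clarify)
    fix t b t' b' assume *: "t * K + 2 * b = t' * K + 2 * b'" "b < K div 2" "b' < K div 2"
    then have "(t * K + 2 * b) div K = (t' * K + 2 * b') div K" "(t * K + 2 * b) mod K = (t' * K + 2 * b') mod K"
      by simp_all
    then show "t = t' \<and> b = b'" using K *(2,3) by simp
  qed
  moreover have "?f ` ?D \<subseteq> free_rows K n"
    using K by (auto simp: free_rows_def)
  moreover have "finite (free_rows K n)"
    using free_rows_subset finite_paired by (rule finite_subset)
  ultimately have "card ?D \<le> card (free_rows K n)" by (intro card_inj_on_le)
  then show ?thesis by (simp add: card_cartesian_product)
qed

lemma card_le_fibrewise: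
  assumes "finite A" "finite B"
    and "\<And>b. b \<in> g ` A \<Longrightarrow> card {x \<in> A. g x = b} \<le> card {x \<in> B. g x = b}"
  shows "card A \<le> card B"
proof -
  have "card A = (\<Sum>b\<in>g ` A. card {x \<in> A. g x = b})"
    using sum.image_gen[OF assms(1), of "\<lambda>_. 1" g] unfolding card_eq_sum .
  also have "\<dots> \<le> (\<Sum>b\<in>g ` A. card {x \<in> B. g x = b})" by (rule sum_mono) (rule assms(3))
  also have "\<dots> = card (\<Union>b\<in>g ` A. {x \<in> B. g x = b})"
    using assms by (intro card_UN_disjoint[symmetric]) auto
  also have "\<dots> \<le> card B" using assms by (intro card_mono) auto
  finally show ?thesis .
qed

text \<open>
  The two sides are compared separately for each pair of labels \<open>2 b\<close>, \<open>2 b + 1\<close>. If \<open>\<pi>\<close> fixes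
  both labels, then every row in which the exchange sets differ is a mismatch. Otherwise \<open>\<pi>\<close> moves
  one of the two labels, and all anchors with that label are mismatches; there are at least as
  many of them as rows that could be exchanged.
\<close>
lemma hamming_le_relabelled_mismatches:
  assumes S: "S \<subseteq> free_rows K n" and S': "S' \<subseteq> free_rows K n"
  shows "card (sym_diff S S') \<le> card {i. i < n \<and> label K S i \<noteq> \<pi> (label K S' i)}"
proof (rule card_le_fibrewise[where g = "\<lambda>i. i mod K div 2"])
  let ?B = "{i. i < n \<and> label K S i \<noteq> \<pi> (label K S' i)}"
  have sub: "S \<subseteq> paired K n" "S' \<subseteq> paired K n" using S S' free_rows_subset by blast+
  show fin: "finite (sym_diff S S')" using finite_subset[OF sub(1) finite_paired] finite_subset[OF sub(2) finite_paired] by auto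
  fix b assume "b \<in> (\<lambda>i. i mod K div 2) ` sym_diff S S'"
  then obtain j where "j \<in> sym_diff S S'" "b = j mod K div 2" by auto
  then have b: "Suc (2 * b) < K" using S S' by (auto simp: free_rows_def)
  let ?D = "{i \<in> sym_diff S S'. i mod K div 2 = b}" and ?Bb = "{i \<in> ?B. i mod K div 2 = b}"
  have D: "even (i mod K)" "i mod K = 2 * b" "Suc i < n" if "i \<in> ?D" for i
    using that sub by (auto simp: paired_def)
  show "card ?D \<le> card ?Bb"
  proof (cases "\<pi> (2 * b) = 2 * b \<and> \<pi> (Suc (2 * b)) = Suc (2 * b)")
    case True
    have "?D \<subseteq> ?Bb"
    proof
      fix i assume i: "i \<in> ?D"
      have "i \<in> paired K n" using i sub by auto
      then have notin: "i \<notin> Suc ` S" "i \<notin> Suc ` S'"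
        using sub Suc_notin_paired by fast+
      consider "i \<in> S" "i \<notin> S'" | "i \<in> S'" "i \<notin> S" using i by auto
      then have "label K S i \<noteq> \<pi> (label K S' i)"
      proof cases
        case 1
        then show ?thesis using label_simps[OF sub(1)] label_simps[OF sub(2)] notin D[OF i] True by simp
      next
        case 2
        then show ?thesis using label_simps[OF sub(1)] label_simps[OF sub(2)] notin D[OF i] True by simp
      qed
      then show "i \<in> ?Bb" using i D[OF i] by auto
    qed
    then show ?thesis by (intro card_mono) auto
  next
    case False
    define k where "k = (if \<pi> (2 * b) = 2 * b then Suc (2 * b) else 2 * b)"
    have k: "\<pi> k \<noteq> k" "k < K" "k div 2 = b" using False b by (auto simp: k_def)
    let ?s = "n div K"
    let ?a = "?s - ?s div 2"
    have inj: "inj_on (\<lambda>t. t * K + k) A" for A using k by (auto simp: inj_on_def)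
    have "(\<lambda>t. t * K + k) ` {..<?a} \<subseteq> ?Bb"
    proof clarify
      fix t assume t: "t < ?a"
      let ?i = "t * K + k"
      have mod: "?i mod K = k" "?i div K = t" using k by auto
      have "Suc t * K \<le> n div K * K" using t by (intro mult_le_mono1) auto
      also have "\<dots> \<le> n" by simp
      finally have "?i < n" using k by simp
      have "label K R ?i = k" if R: "R \<subseteq> free_rows K n" for R
      proof -
        have "?i \<notin> R" using R mod t by (auto simp: free_rows_def)
        moreover have "?i \<notin> Suc ` R"
        proof
          assume "?i \<in> Suc ` R"
          then obtain j where j: "j \<in> R" "?i = Suc j" by auto
          then have jp: "j \<in> paired K n" using R free_rows_subset by blast
          have "Suc j div K = j div K"
            using jp by (auto simp: paired_def div_Suc mod_Suc)
          then have "j div K = t" using mod(2) j(2) by simp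
          then show False using j(1) R t by (auto simp: free_rows_def)
        qed
        moreover have "R \<subseteq> paired K n" using R free_rows_subset by blast
        ultimately have "label K R ?i = ?i mod K" by (intro label_simps(3))
        then show ?thesis by (simp only: mod)
      qed
      then show "?i \<in> ?B \<and> ?i mod K div 2 = b"
        using S S' \<open>?i < n\<close> k mod by auto
    qed
    then have "card ((\<lambda>t. t * K + k) ` {..<?a}) \<le> card ?Bb" by (intro card_mono) auto
    then have "?a \<le> card ?Bb" by (simp add: card_image inj)
    moreover have "card ?D \<le> ?s div 2"
    proof -
      have "inj_on (\<lambda>i. i div K) ?D"
      proof (rule inj_onI)
        fix i j assume ij: "i \<in> ?D" "j \<in> ?D" "i div K = j div K"
        have "i mod K = j mod K" using D(2)[OF ij(1)] D(2)[OF ij(2)] by (simp only:)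
        then show "i = j" using ij(3) by (metis div_mult_mod_eq)
      qed
      moreover have "(\<lambda>i. i div K) ` ?D \<subseteq> {?a..<?s}"
        using S S' by (auto simp: free_rows_def)
      ultimately have "card ?D \<le> card {?a..<?s}" by (intro card_inj_on_le) auto
      then show ?thesis by simp
    qed
    ultimately show ?thesis by linarith
  qed
qed simp

lemma misclustering_rate_attained:
  assumes "0 < n"
  obtains \<pi> where "\<pi> permutes {..<K}"
    and "real n * misclustering_rate n K zh z = real (card {i. i < n \<and> zh i \<noteq> \<pi> (z i)})"
proof -
  let ?f = "\<lambda>\<pi>. \<Sum>i<n. of_bool (zh i \<noteq> \<pi> (z i)) :: real"
  have "finite {\<pi>. \<pi> permutes {..<K}}" by (simp add: finite_permutations)
  moreover have "{\<pi>. \<pi> permutes {..<K}} \<noteq> {}" using permutes_id by blast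
  ultimately have "Min (?f ` {\<pi>. \<pi> permutes {..<K}}) \<in> ?f ` {\<pi>. \<pi> permutes {..<K}}"
    by (intro Min_in) auto
  then obtain \<pi> where \<pi>: "\<pi> permutes {..<K}" "Min (?f ` {\<pi>. \<pi> permutes {..<K}}) = ?f \<pi>" by auto
  have "?f \<pi> = real (card {i. i < n \<and> zh i \<noteq> \<pi> (z i)})"
    by (simp add: of_bool_def sum.If_cases Int_def conj_commute)
  then show ?thesis using that[OF \<pi>(1)] \<pi>(2) assms by (simp add: misclustering_rate_def)
qed

text \<open>
  The misclustering count is a minimum of Hamming distances over relabellings. If \<open>\<pi>\<close> and \<open>\<rho>\<close> are
  optimal for two labellings, then the triangle inequality through the estimate compares these
  labellings up to the relabelling \<open>inv_into UNIV \<pi> \<circ> \<rho>\<close>.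
\<close>
lemma hamming_le_misclustering:
  assumes n: "0 < n" and S: "S \<subseteq> free_rows K n" and S': "S' \<subseteq> free_rows K n"
  shows "real (card (sym_diff S S'))
    \<le> real n * misclustering_rate n K zh (label K S) + real n * misclustering_rate n K zh (label K S')"
proof -
  obtain \<pi> where \<pi>: "\<pi> permutes {..<K}" "real n * misclustering_rate n K zh (label K S)
      = real (card {i. i < n \<and> zh i \<noteq> \<pi> (label K S i)})"
    using misclustering_rate_attained[OF n] by blast
  obtain \<rho> where \<rho>: "\<rho> permutes {..<K}" "real n * misclustering_rate n K zh (label K S')
      = real (card {i. i < n \<and> zh i \<noteq> \<rho> (label K S' i)})"
    using misclustering_rate_attained[OF n] by blast
  have "card (sym_diff S S') \<le> card {i. i < n \<and> label K S i \<noteq> (inv_into UNIV \<pi> \<circ> \<rho>) (label K S' i)}"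
    using S S' by (rule hamming_le_relabelled_mismatches)
  also have "\<dots> \<le> card ({i. i < n \<and> zh i \<noteq> \<pi> (label K S i)} \<union> {i. i < n \<and> zh i \<noteq> \<rho> (label K S' i)})"
  proof (rule card_mono)
    show "{i. i < n \<and> label K S i \<noteq> (inv_into UNIV \<pi> \<circ> \<rho>) (label K S' i)}
        \<subseteq> {i. i < n \<and> zh i \<noteq> \<pi> (label K S i)} \<union> {i. i < n \<and> zh i \<noteq> \<rho> (label K S' i)}"
    proof
      fix i assume i: "i \<in> {i. i < n \<and> label K S i \<noteq> (inv_into UNIV \<pi> \<circ> \<rho>) (label K S' i)}"
      have "\<pi> (label K S i) \<noteq> \<rho> (label K S' i)"
      proof
        assume "\<pi> (label K S i) = \<rho> (label K S' i)"
        then show False using i permutes_inverses(2)[OF \<pi>(1), of "label K S i"] by simp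
      qed
      then show "i \<in> {i. i < n \<and> zh i \<noteq> \<pi> (label K S i)} \<union> {i. i < n \<and> zh i \<noteq> \<rho> (label K S' i)}"
        using i by auto
    qed
  qed simp
  also have "\<dots> \<le> card {i. i < n \<and> zh i \<noteq> \<pi> (label K S i)} + card {i. i < n \<and> zh i \<noteq> \<rho> (label K S' i)}"
    by (rule card_Un_le)
  finally show ?thesis unfolding \<pi>(2) \<rho>(2) by linarith
qed

section \<open>Membership matrices of the labellings\<close>
definition label_mat :: "nat \<Rightarrow> nat \<Rightarrow> nat set \<Rightarrow> real mat" where
  "label_mat n K S = mat n K (\<lambda>(i, k). of_bool (label K S i = k))"

lemma label_mat_membership:
  assumes "0 < K"
  shows "label_mat n K S \<in> membership_mats n K"
proof -
  have "\<exists>!k. k < K \<and> label_mat n K S $$ (i, k) = 1" if "i < n" for i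
    using that label_less[OF assms] by (intro ex1I[of _ "label K S i"]) (auto simp: label_mat_def)
  moreover have "elements_mat (label_mat n K S) \<subseteq> {0, 1}"
    by (auto simp: elements_mat_def label_mat_def)
  ultimately show ?thesis by (auto simp: membership_mats_def label_mat_def)
qed

lemma partition_fun_label_mat:
  assumes "0 < K" "i < n"
  shows "partition_fun (label_mat n K S) i = label K S i"
  unfolding partition_fun_def
  by (rule the_equality) (use assms label_less[OF assms(1)] in \<open>auto simp: label_mat_def split: if_splits\<close>)

lemma misclustering_rate_label_mat:
  assumes "0 < K"
  shows "misclustering_rate n K zh (partition_fun (label_mat n K S)) = misclustering_rate n K zh (label K S)"
  unfolding misclustering_rate_def using partition_fun_label_mat[OF assms] by simp

lemma community_label_mat:
  assumes "k < K"
  shows "community (label_mat n K S) k = {i. i < n \<and> label K S i = k}"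
  using assms by (auto simp: community_def label_mat_def)

lemma prob_mat_label_mat:
  assumes K: "0 < K" and i: "i < n1" and j: "j < n2"
  shows "prob_mat K (label_mat n1 K S) (label_mat n2 K D) p q $$ (i, j)
    = (if label K S i = label K D j then p else q)"
proof -
  have conn: "connectivity K p q $$ (k, l) = (if k = l then p else q)" if "k < K" "l < K" for k l
    using that by (simp add: connectivity_def ones_vec_def scalar_prod_def)
  have dim: "connectivity K p q \<in> carrier_mat K K"
    by (rule carrier_matI) (simp_all add: connectivity_def ones_vec_def)
  have row: "(label_mat n1 K S * connectivity K p q) $$ (i, l) = (if label K S i = l then p else q)"
    if l: "l < K" for l
  proof -
    have "(label_mat n1 K S * connectivity K p q) $$ (i, l)
        = (\<Sum>k\<in>{0..<K}. of_bool (label K S i = k) * connectivity K p q $$ (k, l))"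
      using i l dim by (simp add: label_mat_def scalar_prod_def)
    also have "\<dots> = (\<Sum>k\<in>{0..<K}. if k = label K S i then connectivity K p q $$ (k, l) else 0)"
      by (intro sum.cong) auto
    also have "\<dots> = connectivity K p q $$ (label K S i, l)"
      using label_less[OF K] by simp
    finally show ?thesis using conn l label_less[OF K] by simp
  qed
  have "prob_mat K (label_mat n1 K S) (label_mat n2 K D) p q $$ (i, j)
      = (\<Sum>l\<in>{0..<K}. (label_mat n1 K S * connectivity K p q) $$ (i, l) * of_bool (label K D j = l))"
    unfolding prob_mat_def using i j dim by (simp add: label_mat_def scalar_prod_def)
  also have "\<dots> = (\<Sum>l\<in>{0..<K}. if l = label K D j then (if label K S i = l then p else q) else 0)"
    by (intro sum.cong) (auto simp: row)
  also have "\<dots> = (if label K S i = label K D j then p else q)"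
    using label_less[OF K] by simp
  finally show ?thesis .
qed

section \<open>The mixture over column exchanges and its factorization\<close>

text \<open>
  This form of expanding a product turns an average over subsets \<open>D\<close> of column exchanges into a
  product over the individual exchanges.
\<close>
lemma prod_plus_eq_sum_Pow:
  fixes f g :: "'a \<Rightarrow> real"
  assumes "finite A"
  shows "(\<Prod>x\<in>A. f x + g x) = (\<Sum>X\<in>Pow A. \<Prod>x\<in>A. if x \<in> X then f x else g x)"
  unfolding prod_add[OF assms]
proof (rule sum.cong[OF refl])
  fix X assume "X \<in> Pow A"
  then have "A \<inter> X = X" by auto
  then show "(\<Prod>x\<in>X. f x) * (\<Prod>x\<in>A - X. g x) = (\<Prod>x\<in>A. if x \<in> X then f x else g x)"
    using assms by (simp add: prod.If_cases Diff_eq)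
qed

lemma affinity_self:
  assumes "\<And>X. 0 \<le> P X"
  shows "affinity I P P = (\<Sum>X\<in>Pow I. P X)"
  using assms by (simp add: affinity_def)

lemma affinity_le_1:
  assumes "finite I" and "\<And>X. 0 \<le> P X" "\<And>X. 0 \<le> Q X"
    and "(\<Sum>X\<in>Pow I. P X) = 1" "(\<Sum>X\<in>Pow I. Q X) = 1"
  shows "affinity I P Q \<le> 1"
proof -
  have "affinity I P Q \<le> (\<Sum>X\<in>Pow I. (P X + Q X) / 2)"
    unfolding affinity_def by (intro sum_mono arith_geo_mean_sqrt assms)
  then show ?thesis using assms by (simp add: sum_divide_distrib[symmetric] sum.distrib)
qed

lemma one_minus_power_ge:
  fixes p :: real
  assumes "p \<le> 1"
  shows "1 - real n * p \<le> (1 - p) ^ n"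
  using Bernoulli_inequality[of "- p" n] assms by simp

locale paired_design =
  fixes K n1 n2 :: nat and p q :: real
  assumes K: "2 \<le> K" and q: "0 \<le> q" "q \<le> p" and p: "p \<le> 1"
begin

definition edge_prob :: "nat set \<Rightarrow> nat set \<Rightarrow> nat \<times> nat \<Rightarrow> real" where
  "edge_prob S D = (\<lambda>(i, j). if label K S i = label K D j then p else q)"

text \<open>
  The columns are split into blocks: a column that may be exchanged forms a block with its right
  neighbour, every other column is a block of its own. Each block is represented by its first
  column.
\<close>
definition leaders :: "nat set" where
  "leaders = {..<n2} - Suc ` paired K n2"

definition cols :: "nat \<Rightarrow> nat set" where
  "cols j = (if j \<in> paired K n2 then {j, Suc j} else {j})"

definition block :: "nat \<Rightarrow> (nat \<times> nat) set" where
  "block j = {..<n1} \<times> cols j"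

text \<open>
  The average over the coin of the block. For a block with a single column there is no coin: the
  intersection is empty and both summands agree.
\<close>
definition block_law :: "nat set \<Rightarrow> nat \<Rightarrow> (nat \<times> nat) set \<Rightarrow> real" where
  "block_law S j X = (bernoulli_weight (edge_prob S {}) (block j) X
     + bernoulli_weight (edge_prob S ({j} \<inter> paired K n2)) (block j) X) / 2"

definition law :: "nat set \<Rightarrow> (nat \<times> nat) set \<Rightarrow> real" where
  "law S X = (\<Sum>D\<in>Pow (paired K n2). bernoulli_weight (edge_prob S D) ({..<n1} \<times> {..<n2}) X)
     / 2 ^ card (paired K n2)"

lemma edge_prob_bounds: "0 \<le> edge_prob S D e \<and> edge_prob S D e \<le> p"
  using q by (auto simp: edge_prob_def split: prod.split)

lemma edge_prob_bounds_1: "0 \<le> edge_prob S D e \<and> edge_prob S D e \<le> 1"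
  using edge_prob_bounds[of S D e] p by linarith

lemma weight_nonneg: "0 \<le> bernoulli_weight (edge_prob S D) I X"
  by (rule bernoulli_weight_nonneg) (rule edge_prob_bounds_1)

lemma paired_subset_leaders: "paired K n2 \<subseteq> leaders"
  using Suc_notin_paired[of _ K n2] by (auto simp: leaders_def paired_def[of K n2] dest: Suc_lessD)

lemma finite_leaders: "finite leaders"
  by (simp add: leaders_def)

lemma finite_block: "finite (block j)"
  by (simp add: block_def cols_def)

lemma UN_block: "(\<Union>j\<in>leaders. block j) = {..<n1} \<times> {..<n2}"
proof -
  have "(\<Union>j\<in>leaders. cols j) = {..<n2}"
  proof
    show "(\<Union>j\<in>leaders. cols j) \<subseteq> {..<n2}"
      by (auto simp: leaders_def cols_def paired_def split: if_splits)
    show "{..<n2} \<subseteq> (\<Union>j\<in>leaders. cols j)"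
    proof
      fix c assume c: "c \<in> {..<n2}"
      show "c \<in> (\<Union>j\<in>leaders. cols j)"
      proof (cases "c \<in> Suc ` paired K n2")
        case True
        then obtain j where "j \<in> paired K n2" "c = Suc j" by auto
        then show ?thesis using paired_subset_leaders by (auto simp: cols_def)
      next
        case False
        then have "c \<in> leaders" using c by (simp add: leaders_def)
        then show ?thesis by (auto simp: cols_def)
      qed
    qed
  qed
  then show ?thesis by (auto simp: block_def)
qed

lemma disjoint_block: "disjoint_family_on block leaders"
  by (auto simp: disjoint_family_on_def block_def cols_def leaders_def split: if_splits)

lemma block_law_Int: "block_law S j (X \<inter> block j) = block_law S j X"
  by (simp add: block_law_def bernoulli_weight_Int)

lemma block_law_nonneg: "0 \<le> block_law S j X"
  by (simp add: block_law_def weight_nonneg)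

lemma sum_block_law: "(\<Sum>X\<in>Pow (block j). block_law S j X) = 1"
  by (simp add: block_law_def sum_divide_distrib[symmetric] sum.distrib sum_bernoulli_weight finite_block)

lemma law_nonneg: "0 \<le> law S X"
  by (simp add: law_def weight_nonneg sum_nonneg)

lemma sum_law: "(\<Sum>X\<in>Pow ({..<n1} \<times> {..<n2}). law S X) = 1"
proof -
  have "(\<Sum>X\<in>Pow ({..<n1} \<times> {..<n2}). law S X)
      = (\<Sum>D\<in>Pow (paired K n2). \<Sum>X\<in>Pow ({..<n1} \<times> {..<n2}). bernoulli_weight (edge_prob S D) ({..<n1} \<times> {..<n2}) X)
        / 2 ^ card (paired K n2)"
    unfolding law_def by (simp only: sum_divide_distrib sum.swap[of _ _ "Pow (paired K n2)"])
  also have "\<dots> = 1"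
    by (simp add: sum_bernoulli_weight card_Pow finite_paired)
  finally show ?thesis .
qed

lemma label_leader:
  assumes j: "j \<in> leaders" and c: "c \<in> cols j" and D: "D \<subseteq> paired K n2"
  shows "label K D c = label K (if j \<in> D then {j} \<inter> paired K n2 else {}) c"
proof (rule label_cong)
  show "c \<in> D \<longleftrightarrow> c \<in> (if j \<in> D then {j} \<inter> paired K n2 else {})"
    using c D Suc_notin_paired[of j K n2] by (auto simp: cols_def split: if_splits)
  show "c \<in> Suc ` D \<longleftrightarrow> c \<in> Suc ` (if j \<in> D then {j} \<inter> paired K n2 else {})"
    using c D j by (auto simp: cols_def leaders_def split: if_splits)
qed

text \<open>
  Within a block, the column labels depend only on the coin of that block; hence averaging over
  all sets of exchanges means averaging in each block independently.
\<close>
lemma law_eq_prod_block_law: "law S X = (\<Prod>j\<in>leaders. block_law S j X)"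
proof -
  let ?U = "paired K n2"
  define a where "a j = bernoulli_weight (edge_prob S ({j} \<inter> ?U)) (block j) X" for j
  define b where "b j = bernoulli_weight (edge_prob S {}) (block j) X" for j
  have weight: "bernoulli_weight (edge_prob S D) ({..<n1} \<times> {..<n2}) X
      = (\<Prod>j\<in>leaders - ?U. b j) * (\<Prod>j\<in>?U. if j \<in> D then a j else b j)" if D: "D \<in> Pow ?U" for D
  proof -
    have "bernoulli_weight (edge_prob S D) ({..<n1} \<times> {..<n2}) X
        = (\<Prod>j\<in>leaders. bernoulli_weight (edge_prob S D) (block j) X)"
      unfolding UN_block[symmetric]
      by (rule bernoulli_weight_UN) (simp_all add: finite_leaders finite_block disjoint_block)
    also have "\<dots> = (\<Prod>j\<in>leaders. if j \<in> D then a j else b j)"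
    proof (rule prod.cong[OF refl])
      fix j assume j: "j \<in> leaders"
      have "bernoulli_weight (edge_prob S D) (block j) X
          = bernoulli_weight (edge_prob S (if j \<in> D then {j} \<inter> ?U else {})) (block j) X"
      proof (rule bernoulli_weight_cong)
        fix e assume "e \<in> block j"
        then obtain i c where e: "e = (i, c)" "c \<in> cols j" by (auto simp: block_def)
        show "edge_prob S D e = edge_prob S (if j \<in> D then {j} \<inter> ?U else {}) e"
          unfolding edge_prob_def e(1) prod.case using label_leader[OF j e(2)] D by (metis PowD)
      qed
      then show "bernoulli_weight (edge_prob S D) (block j) X = (if j \<in> D then a j else b j)"
        by (simp add: a_def b_def)
    qed
    also have "\<dots> = (\<Prod>j\<in>leaders - ?U. if j \<in> D then a j else b j) * (\<Prod>j\<in>?U. if j \<in> D then a j else b j)"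
      by (rule prod.subset_diff[OF paired_subset_leaders finite_leaders])
    also have "(\<Prod>j\<in>leaders - ?U. if j \<in> D then a j else b j) = (\<Prod>j\<in>leaders - ?U. b j)"
      using D by (intro prod.cong) auto
    finally show ?thesis .
  qed
  have "law S X = (\<Prod>j\<in>leaders - ?U. b j) * (\<Prod>j\<in>?U. a j + b j) / 2 ^ card ?U"
    unfolding law_def prod_plus_eq_sum_Pow[OF finite_paired] sum_distrib_left
    by (simp only: sum.cong[OF refl weight])
  also have "\<dots> = (\<Prod>j\<in>leaders - ?U. b j) * (\<Prod>j\<in>?U. (a j + b j) / 2)"
    by (simp add: prod_dividef)
  also have "\<dots> = (\<Prod>j\<in>leaders - ?U. block_law S j X) * (\<Prod>j\<in>?U. block_law S j X)"
    by (intro arg_cong2[where f = "(*)"] prod.cong) (auto simp: block_law_def a_def b_def)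
  also have "\<dots> = (\<Prod>j\<in>leaders. block_law S j X)"
    by (rule prod.subset_diff[OF paired_subset_leaders finite_leaders, symmetric])
  finally show ?thesis .
qed

lemma affinity_law:
  "affinity ({..<n1} \<times> {..<n2}) (law S) (law S')
    = (\<Prod>j\<in>leaders. affinity (block j) (block_law S j) (block_law S' j))"
  unfolding law_eq_prod_block_law[abs_def] UN_block[symmetric]
  by (rule affinity_UN) (simp_all add: finite_leaders finite_block disjoint_block block_law_Int)

section \<open>Testing a single exchange of rows\<close>

text \<open>
  The two hypotheses are that the rows \<open>t\<close>, \<open>t + 1\<close> keep their labels or exchange them, all other
  rows having known labels.
\<close>
context
  fixes t :: nat and S :: "nat set"
  assumes t: "t \<in> paired K n1" and S: "S \<subseteq> paired K n1 - {t}"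
begin

lemma row_label:
  shows "label K S t = t mod K" "label K S (Suc t) = Suc (t mod K)"
    and "label K (insert t S) t = Suc (t mod K)" "label K (insert t S) (Suc t) = t mod K"
    and "i \<noteq> t \<Longrightarrow> i \<noteq> Suc t \<Longrightarrow> label K (insert t S) i = label K S i"
proof -
  have sub: "S \<subseteq> paired K n1" "insert t S \<subseteq> paired K n1" using t S by auto
  have notin: "t \<notin> S" "t \<notin> Suc ` S" "Suc t \<notin> S" "Suc t \<notin> Suc ` S"
    using t S by (auto dest: Suc_notin_paired)
  show "label K S t = t mod K" "label K S (Suc t) = Suc (t mod K)"
    using notin label_simps(3)[OF sub(1)] Suc_mod_paired[OF t] by auto
  show "label K (insert t S) t = Suc (t mod K)" "label K (insert t S) (Suc t) = t mod K"
    using label_simps(1,2)[OF sub(2), of t] by auto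
  show "label K (insert t S) i = label K S i" if "i \<noteq> t" "i \<noteq> Suc t"
    using that by (intro label_cong) auto
qed

lemma edge_prob_insert_other: "i \<notin> {t, Suc t} \<Longrightarrow> edge_prob (insert t S) D (i, c) = edge_prob S D (i, c)"
  by (simp add: edge_prob_def row_label(5))

lemma t_mod: "even (t mod K)" "Suc (t mod K) < K" "Suc t < n1"
  using t by (auto simp: paired_def)

text \<open>
  A column with the odd label of a pair is always the second one of its block, because its left
  neighbour has the even label.
\<close>
lemma leader_mod:
  assumes j: "j \<in> leaders" and "j mod K div 2 = t mod K div 2"
  shows "j mod K = t mod K"
proof (rule ccontr)
  assume "j mod K \<noteq> t mod K"
  then have jm: "j mod K = Suc (t mod K)"
    using assms(2) t_mod(1) by (metis even_two_times_div_two odd_two_times_div_two_succ Suc_eq_plus1)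
  then obtain i where i: "j = Suc i" by (cases j) auto
  then have "i mod K = t mod K" using jm by (auto simp: mod_Suc split: if_splits)
  then have "i \<in> paired K n2" using t_mod j i by (auto simp: paired_def leaders_def)
  then show False using j i by (auto simp: leaders_def)
qed

text \<open>
  Column labels outside the pair of the tested rows differ from both candidate labels, so all
  probabilities in these two rows are \<open>q\<close> under either hypothesis.
\<close>
lemma affinity_block_other:
  assumes j: "j \<in> leaders" and ne: "j mod K \<noteq> t mod K"
  shows "affinity (block j) (block_law S j) (block_law (insert t S) j) = 1"
proof -
  have jt: "j mod K div 2 \<noteq> t mod K div 2" using leader_mod[OF j] ne by blast
  have "edge_prob (insert t S) D e = edge_prob S D e" if D: "D \<subseteq> paired K n2" and e: "e \<in> block j" for D e
  proof -
    obtain i c where ic: "e = (i, c)" "c \<in> cols j" using e by (auto simp: block_def)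
    show ?thesis
    proof (cases "i = t \<or> i = Suc t")
      case True
      have "c mod K div 2 = j mod K div 2"
        using ic(2) Suc_mod_paired[of j K n2] by (auto simp: cols_def paired_def split: if_splits)
      then have "label K D c div 2 \<noteq> t mod K div 2" using label_div_2[OF D] jt by simp
      then have "label K D c \<noteq> t mod K" "label K D c \<noteq> Suc (t mod K)" using t_mod(1) by auto
      then show ?thesis using True row_label(1-4) by (auto simp: edge_prob_def ic)
    qed (simp add: edge_prob_def ic row_label(5))
  qed
  then have "block_law (insert t S) j = block_law S j"
    unfolding block_law_def by (intro ext arg_cong2[where f = "(/)"] arg_cong2[where f = "(+)"]
      bernoulli_weight_cong refl) auto
  then show ?thesis by (simp add: affinity_self block_law_nonneg sum_block_law)
qed

text \<open>
  A column without a partner has a known label and thus carries first order information; it is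
  harmless since there is at most one such column with a relevant label (the last one).
\<close>
lemma affinity_block_unpaired:
  assumes "j \<notin> paired K n2"
  shows "(1 - p)\<^sup>2 \<le> affinity (block j) (block_law S j) (block_law (insert t S) j)"
proof -
  have law: "block_law R j = bernoulli_weight (edge_prob R {}) (block j)" for R
    using assms by (auto simp: block_law_def fun_eq_iff)
  have "(1 - p) ^ card ({t, Suc t} \<times> {j})
      \<le> affinity (block j) (block_law S j) (block_law (insert t S) j)"
    unfolding law
  proof (rule affinity_bernoulli_weight_ge)
    show "{t, Suc t} \<times> {j} \<subseteq> block j" using t_mod(3) by (auto simp: block_def cols_def)
    show "edge_prob S {} e = edge_prob (insert t S) {} e" if "e \<in> block j - {t, Suc t} \<times> {j}" for e
    proof -
      obtain i c where "e = (i, c)" by (cases e)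
      then show ?thesis using that assms by (auto simp: block_def cols_def edge_prob_insert_other)
    qed
  qed (use p edge_prob_bounds finite_block in auto)
  then show ?thesis by (simp add: numeral_2_eq_2)
qed

lemma card_rows_of_pair:
  "card {i. i < n1 \<and> (label K S i = t mod K \<or> label K S i = Suc (t mod K))} \<le> 2 * Suc (n1 div K)"
proof -
  have sub: "S \<subseteq> paired K n1" using S by auto
  let ?C = "\<lambda>k. {i. i < n1 \<and> label K S i = k}"
  have C: "card (?C k) \<le> Suc (n1 div K)" if "k < K" for k
    using card_label_class[OF sub] card_residue_class(2)[OF that] by simp
  have "{i. i < n1 \<and> (label K S i = t mod K \<or> label K S i = Suc (t mod K))}
      = ?C (t mod K) \<union> ?C (Suc (t mod K))" by auto
  then have "card {i. i < n1 \<and> (label K S i = t mod K \<or> label K S i = Suc (t mod K))}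
      \<le> card (?C (t mod K)) + card (?C (Suc (t mod K)))" by (simp add: card_Un_le)
  also have "\<dots> \<le> Suc (n1 div K) + Suc (n1 div K)"
    using t_mod(2) by (intro add_mono C) auto
  finally show ?thesis by simp
qed

text \<open>
  Exchanging the two columns and exchanging the two rows have the same effect on the four entries
  in these rows and columns, which gives the crossed mixtures of \<open>affinity_mixture_ge\<close>. The first
  factor of the deficit comes from the about \<open>4 n1 / K\<close> other entries in rows with one of the two
  labels, the second factor from the four entries themselves.
\<close>
lemma affinity_block_paired:
  assumes j: "j \<in> paired K n2" and jt: "j mod K = t mod K"
  shows "1 - 64 * real (Suc (n1 div K)) * p\<^sup>2
    \<le> affinity (block j) (block_law S j) (block_law (insert t S) j)"
proof -
  let ?G = "{t, Suc t} \<times> {j, Suc j}" and ?R = "({..<n1} - {t, Suc t}) \<times> {j, Suc j}"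
  let ?F0 = "bernoulli_weight (edge_prob S {}) ?R" and ?F1 = "bernoulli_weight (edge_prob S {j}) ?R"
  let ?g0 = "bernoulli_weight (edge_prob S {}) ?G" and ?g1 = "bernoulli_weight (edge_prob S {j}) ?G"
  have block: "block j = ?R \<union> ?G" using j t_mod(3) by (auto simp: block_def cols_def)
  have disj: "?R \<inter> ?G = {}" by auto
  have jU: "{j} \<inter> paired K n2 = {j}" using j by auto
  have col: "label K {} j = t mod K" "label K {} (Suc j) = Suc (t mod K)"
    "label K {j} j = Suc (t mod K)" "label K {j} (Suc j) = t mod K"
    using label_simps[of "{}" K n2] label_simps[of "{j}" K n2] j jt Suc_mod_paired[OF j] by auto
  have "bernoulli_weight (edge_prob (insert t S) D) ?R X = bernoulli_weight (edge_prob S D) ?R X" for D X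
  proof (rule bernoulli_weight_cong)
    fix e assume "e \<in> ?R"
    then obtain i c where "e = (i, c)" "i \<notin> {t, Suc t}" by blast
    then show "edge_prob (insert t S) D e = edge_prob S D e" by (simp add: edge_prob_insert_other)
  qed
  moreover have "bernoulli_weight (edge_prob (insert t S) {}) ?G X = ?g1 X"
    "bernoulli_weight (edge_prob (insert t S) {j}) ?G X = ?g0 X" for X
    by (rule bernoulli_weight_cong; auto simp: edge_prob_def row_label(1-4) col)+
  ultimately have laws: "block_law S j = (\<lambda>X. (?F0 X * ?g0 X + ?F1 X * ?g1 X) / 2)"
    "block_law (insert t S) j = (\<lambda>X. (?F0 X * ?g1 X + ?F1 X * ?g0 X) / 2)"
    unfolding block_law_def block jU
    by (simp_all only: bernoulli_weight_Un[OF _ _ disj] finite_cartesian_product finite_Diff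
        finite_lessThan finite.intros)
  have G: "1 - affinity ?G ?g0 ?g1 \<le> 4 * p"
  proof -
    have "(1 - p) ^ card ?G \<le> affinity ?G ?g0 ?g1"
      by (rule affinity_bernoulli_weight_ge) (use p edge_prob_bounds in auto)
    moreover have "card ?G = 4" by (simp add: card_cartesian_product)
    ultimately have "(1 - p) ^ 4 \<le> affinity ?G ?g0 ?g1" by (simp only:)
    moreover have "1 - 4 * p \<le> (1 - p) ^ 4" using one_minus_power_ge[OF p, of 4] by simp
    ultimately show ?thesis by linarith
  qed
  have R: "1 - affinity ?R ?F0 ?F1 \<le> 4 * real (Suc (n1 div K)) * p"
  proof -
    let ?A = "{i. i < n1 \<and> (label K S i = t mod K \<or> label K S i = Suc (t mod K))}"
    let ?E = "?R \<inter> ?A \<times> {j, Suc j}"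
    have "(1 - p) ^ card ?E \<le> affinity ?R ?F0 ?F1"
    proof (rule affinity_bernoulli_weight_ge)
      show "edge_prob S {} e = edge_prob S {j} e" if e: "e \<in> ?R - ?E" for e
      proof -
        obtain i c where ic: "e = (i, c)" by (cases e)
        have "c = j \<or> c = Suc j" and "label K S i \<noteq> t mod K" "label K S i \<noteq> Suc (t mod K)"
          using e unfolding ic by auto
        then show ?thesis using col by (elim disjE) (simp_all add: edge_prob_def ic)
      qed
    qed (use p edge_prob_bounds in auto)
    moreover have "real (card ?E) * p \<le> 4 * real (Suc (n1 div K)) * p"
    proof (rule mult_right_mono)
      have "card ?E \<le> card (?A \<times> {j, Suc j})" by (intro card_mono) auto
      also have "\<dots> = card ?A * 2" by (simp add: card_cartesian_product)
      also have "\<dots> \<le> 4 * Suc (n1 div K)" using card_rows_of_pair by simp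
      finally have "real (card ?E) \<le> real (4 * Suc (n1 div K))" by (rule of_nat_mono)
      then show "real (card ?E) \<le> 4 * real (Suc (n1 div K))" by (simp only: of_nat_mult of_nat_numeral)
    qed (use q in auto)
    ultimately show ?thesis using one_minus_power_ge[OF p, of "card ?E"] by linarith
  qed
  have "(1 - affinity ?R ?F0 ?F1) * (1 - affinity ?G ?g0 ?g1) \<le> (4 * real (Suc (n1 div K)) * p) * (4 * p)"
  proof (rule mult_mono[OF R G])
    show "0 \<le> 1 - affinity ?G ?g0 ?g1"
      using affinity_le_1[of ?G ?g0 ?g1] by (simp add: weight_nonneg sum_bernoulli_weight)
  qed (use q in auto)
  moreover have "1 - 4 * (1 - affinity ?R ?F0 ?F1) * (1 - affinity ?G ?g0 ?g1)
      \<le> affinity (block j) (block_law S j) (block_law (insert t S) j)"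
    unfolding laws block
    by (rule affinity_mixture_ge[OF _ _ disj])
      (simp_all add: weight_nonneg bernoulli_weight_Int sum_bernoulli_weight)
  moreover have "64 * real (Suc (n1 div K)) * p\<^sup>2 = 4 * ((4 * real (Suc (n1 div K)) * p) * (4 * p))"
    by (simp add: power2_eq_square)
  ultimately show ?thesis
    unfolding mult.assoc[of 4 "1 - affinity ?R ?F0 ?F1"] by linarith
qed

lemma affinity_law_ge:
  assumes small: "64 * real (Suc (n1 div K)) * p\<^sup>2 \<le> 1"
  shows "(1 - 64 * real (Suc (n1 div K)) * p\<^sup>2) ^ Suc (n2 div K) * (1 - p)\<^sup>2
    \<le> affinity ({..<n1} \<times> {..<n2}) (law S) (law (insert t S))"
proof -
  let ?x = "64 * real (Suc (n1 div K)) * p\<^sup>2"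
  let ?A = "{j \<in> leaders. j \<in> paired K n2 \<and> j mod K = t mod K}"
  let ?B = "{j \<in> leaders. j \<notin> paired K n2 \<and> j mod K = t mod K}"
  have p1: "(1 - p)\<^sup>2 \<le> 1" using p q by (simp add: power_le_one)
  have "card ?A \<le> card {j. j < n2 \<and> j mod K = t mod K}"
    by (intro card_mono) (auto simp: leaders_def)
  also have "\<dots> \<le> Suc (n2 div K)" using card_residue_class(2)[of "t mod K" K n2] K by simp
  finally have A: "(1 - ?x) ^ Suc (n2 div K) \<le> (1 - ?x) ^ card ?A"
    using small by (intro power_decreasing) auto
  have "?B \<subseteq> {n2 - 1}" using t_mod by (auto simp: leaders_def paired_def)
  then have "card ?B \<le> 1" by (metis card_mono card.empty card_insert_disjoint empty_iff finite.emptyI finite_insert One_nat_def)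
  then have B: "((1 - p)\<^sup>2) ^ 1 \<le> ((1 - p)\<^sup>2) ^ card ?B"
    using p1 by (intro power_decreasing) auto
  have "(1 - ?x) ^ Suc (n2 div K) * (1 - p)\<^sup>2 \<le> (1 - ?x) ^ card ?A * ((1 - p)\<^sup>2) ^ card ?B"
    using A B small by (intro mult_mono) auto
  also have "\<dots> = (\<Prod>j\<in>leaders. (if j \<in> paired K n2 \<and> j mod K = t mod K then 1 - ?x else 1)
      * (if j \<notin> paired K n2 \<and> j mod K = t mod K then (1 - p)\<^sup>2 else 1))"
    using finite_leaders by (simp add: prod.distrib prod.If_cases Int_def)
  also have "\<dots> \<le> (\<Prod>j\<in>leaders. affinity (block j) (block_law S j) (block_law (insert t S) j))"
  proof (rule prod_mono, rule conjI)
    fix j assume j: "j \<in> leaders"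
    show "0 \<le> (if j \<in> paired K n2 \<and> j mod K = t mod K then 1 - ?x else 1)
        * (if j \<notin> paired K n2 \<and> j mod K = t mod K then (1 - p)\<^sup>2 else 1)"
      using small by auto
    show "(if j \<in> paired K n2 \<and> j mod K = t mod K then 1 - ?x else 1)
        * (if j \<notin> paired K n2 \<and> j mod K = t mod K then (1 - p)\<^sup>2 else 1)
        \<le> affinity (block j) (block_law S j) (block_law (insert t S) j)"
      using affinity_block_other[OF j] affinity_block_unpaired[of j] affinity_block_paired[of j]
      by auto
  qed
  finally show ?thesis by (simp only: affinity_law)
qed

end

section \<open>The risk of an arbitrary estimator\<close>

text \<open>
  The bound on the risk under the mixture over column exchanges is inherited by at least one fixed
  set \<open>D\<close> of column exchanges, hence by a point of the parameter space.
\<close>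
lemma exists_hard_pair:
  fixes zh :: "(nat \<times> nat \<Rightarrow> bool) \<Rightarrow> nat \<Rightarrow> nat" and a :: real
  assumes n1: "0 < n1" and small: "64 * real (Suc (n1 div K)) * p\<^sup>2 \<le> 1"
  defines "a \<equiv> (1 - 64 * real (Suc (n1 div K)) * p\<^sup>2) ^ Suc (n2 div K) * (1 - p)\<^sup>2"
  shows "\<exists>S D. S \<subseteq> paired K n1 \<and> D \<subseteq> paired K n2 \<and>
    real (card (free_rows K n1)) * (a\<^sup>2 / 2) / 4
    \<le> (\<Sum>X\<in>Pow ({..<n1} \<times> {..<n2}). bernoulli_weight (edge_prob S D) ({..<n1} \<times> {..<n2}) X
        * (real n1 * misclustering_rate n1 K (zh (\<lambda>e. e \<in> X)) (label K S)))"
proof -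
  let ?E = "{..<n1} \<times> {..<n2}" and ?U = "paired K n2"
  let ?loss = "\<lambda>S X. real n1 * misclustering_rate n1 K (zh (\<lambda>e. e \<in> X)) (label K S)"
  have "\<exists>S\<subseteq>free_rows K n1. real (card (free_rows K n1)) * (a\<^sup>2 / 2) / 4
      \<le> (\<Sum>X\<in>Pow ?E. law S X * ?loss S X)"
  proof (rule Assouad)
    show "finite (free_rows K n1)" using free_rows_subset finite_paired by (rule finite_subset)
    fix t S assume tS: "t \<in> free_rows K n1" "S \<subseteq> free_rows K n1 - {t}"
    then have t: "t \<in> paired K n1" and S: "S \<subseteq> paired K n1 - {t}" using free_rows_subset by auto
    have "a\<^sup>2 \<le> (affinity ?E (law S) (law (insert t S)))\<^sup>2"
      using affinity_law_ge[OF t S small] small unfolding a_def by (intro power_mono) auto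
    moreover have "(affinity ?E (law S) (law (insert t S)))\<^sup>2 / 2 \<le> (\<Sum>X\<in>Pow ?E. min (law S X) (law (insert t S) X))"
      by (rule sum_min_ge_affinity) (simp_all add: law_nonneg sum_law)
    ultimately show "a\<^sup>2 / 2 \<le> (\<Sum>X\<in>Pow ?E. min (law S X) (law (insert t S) X))" by linarith
  qed (use n1 in \<open>auto simp: law_nonneg intro: hamming_le_misclustering\<close>)
  then obtain S where S: "S \<subseteq> free_rows K n1"
    and risk: "real (card (free_rows K n1)) * (a\<^sup>2 / 2) / 4 \<le> (\<Sum>X\<in>Pow ?E. law S X * ?loss S X)" (is "?r \<le> _")
    by auto
  have "\<exists>D\<in>Pow ?U. ?r \<le> (\<Sum>X\<in>Pow ?E. bernoulli_weight (edge_prob S D) ?E X * ?loss S X)"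
  proof (rule ccontr)
    assume "\<not> ?thesis"
    then have "(\<Sum>X\<in>Pow ?E. bernoulli_weight (edge_prob S D) ?E X * ?loss S X) < ?r" if "D \<in> Pow ?U" for D
      using that by (meson not_le)
    then have "(\<Sum>D\<in>Pow ?U. \<Sum>X\<in>Pow ?E. bernoulli_weight (edge_prob S D) ?E X * ?loss S X) < (\<Sum>D\<in>Pow ?U. ?r)"
      by (rule sum_strict_mono[rotated 2]) (auto simp: finite_paired)
    also have "(\<Sum>D\<in>Pow ?U. ?r) = 2 ^ card ?U * ?r" by (simp add: card_Pow finite_paired)
    also have "\<dots> \<le> 2 ^ card ?U * (\<Sum>X\<in>Pow ?E. law S X * ?loss S X)"
      using risk by (intro mult_left_mono) auto
    also have "\<dots> = (\<Sum>X\<in>Pow ?E. \<Sum>D\<in>Pow ?U. bernoulli_weight (edge_prob S D) ?E X * ?loss S X)"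
    proof -
      have "2 ^ card ?U * (law S X * l) = (\<Sum>D\<in>Pow ?U. bernoulli_weight (edge_prob S D) ?E X * l)" for X l
        by (simp add: law_def sum_distrib_right)
      then show ?thesis by (simp only: sum_distrib_left)
    qed
    also have "\<dots> = (\<Sum>D\<in>Pow ?U. \<Sum>X\<in>Pow ?E. bernoulli_weight (edge_prob S D) ?E X * ?loss S X)"
      by (rule sum.swap)
    finally show False by simp
  qed
  then show ?thesis using S free_rows_subset by blast
qed

lemma expectation_SBiSBM:
  "measure_pmf.expectation (SBiSBM K (label_mat n1 K S) (label_mat n2 K D) p q) f
    = (\<Sum>X\<in>Pow ({..<n1} \<times> {..<n2}). bernoulli_weight (edge_prob S D) ({..<n1} \<times> {..<n2}) X * f (\<lambda>e. e \<in> X))"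
proof -
  let ?E = "{..<n1} \<times> {..<n2}" and ?ind = "\<lambda>X e. e \<in> X"
  let ?P = "prob_mat K (label_mat n1 K S) (label_mat n2 K D) p q"
  let ?L = "SBiSBM K (label_mat n1 K S) (label_mat n2 K D) p q"
  have L: "?L = Pi_pmf ?E False (\<lambda>e. bernoulli_pmf (?P $$ e))"
    by (simp add: SBiSBM_def label_mat_def)
  have "inj_on ?ind (Pow ?E)" by (auto simp: inj_on_def fun_eq_iff)
  have "measure_pmf.expectation ?L f = (\<Sum>A\<in>?ind ` Pow ?E. f A * pmf ?L A)"
  proof (rule integral_measure_pmf_real)
    fix A assume "A \<in> set_pmf ?L"
    then have "A e = False" if "e \<notin> ?E" for e
      using that set_Pi_pmf_subset[of ?E False "\<lambda>e. bernoulli_pmf (?P $$ e)"] unfolding L by blast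
    then have "A = ?ind {e. A e}" "{e. A e} \<in> Pow ?E" by (auto simp: fun_eq_iff)
    then show "A \<in> ?ind ` Pow ?E" by blast
  qed simp
  also have "\<dots> = (\<Sum>X\<in>Pow ?E. f (?ind X) * pmf ?L (?ind X))"
    using \<open>inj_on ?ind (Pow ?E)\<close> by (simp add: sum.reindex)
  also have "\<dots> = (\<Sum>X\<in>Pow ?E. bernoulli_weight (edge_prob S D) ?E X * f (?ind X))"
  proof (rule sum.cong[OF refl])
    fix X assume X: "X \<in> Pow ?E"
    have "pmf ?L (?ind X) = (\<Prod>e\<in>?E. pmf (bernoulli_pmf (?P $$ e)) (e \<in> X))"
      unfolding L using X by (intro pmf_Pi') auto
    also have "\<dots> = bernoulli_weight (edge_prob S D) ?E X"
      unfolding bernoulli_weight_def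
    proof (rule prod.cong[OF refl])
      fix e assume "e \<in> ?E"
      then have "?P $$ e = edge_prob S D e"
        using K prob_mat_label_mat[of K _ n1 _ n2] by (auto simp: edge_prob_def)
      then show "pmf (bernoulli_pmf (?P $$ e)) (e \<in> X) = (if e \<in> X then edge_prob S D e else 1 - edge_prob S D e)"
        using edge_prob_bounds_1[of S D e] by simp
    qed
    finally show "f (?ind X) * pmf ?L (?ind X) = bernoulli_weight (edge_prob S D) ?E X * f (?ind X)" by simp
  qed
  finally show ?thesis .
qed

end

section \<open>Balanced membership matrices\<close>
lemma community_sizes_around_average:
  assumes Z: "Z \<in> membership_mats n K" and K: "0 < K"
  shows "\<exists>k<K. K * card (community Z k) \<le> n" and "\<exists>k<K. n \<le> K * card (community Z k)"
proof -
  have dim: "dim_row Z = n" and ex1: "\<And>i. i < n \<Longrightarrow> \<exists>!k. k < K \<and> Z $$ (i, k) = 1"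
    using Z by (auto simp: membership_mats_def)
  have "{..<n} = (\<Union>k<K. community Z k)"
    using dim ex1 by (fastforce simp: community_def)
  then have "n = card (\<Union>k<K. community Z k)" by (metis card_lessThan)
  also have "\<dots> = (\<Sum>k<K. card (community Z k))"
  proof (rule card_UN_disjoint)
    show "\<forall>k\<in>{..<K}. \<forall>l\<in>{..<K}. k \<noteq> l \<longrightarrow> community Z k \<inter> community Z l = {}"
      using dim ex1 by (auto simp: community_def)
  qed (simp_all add: community_def)
  finally have total: "n = (\<Sum>k<K. card (community Z k))" .
  show "\<exists>k<K. K * card (community Z k) \<le> n"
  proof (rule ccontr)
    assume "\<not> ?thesis"
    then have "(\<Sum>k<K. n) < (\<Sum>k<K. K * card (community Z k))"
      using K by (intro sum_strict_mono) auto
    then show False by (simp add: sum_distrib_left[symmetric] total[symmetric])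
  qed
  show "\<exists>k<K. n \<le> K * card (community Z k)"
  proof (rule ccontr)
    assume "\<not> ?thesis"
    then have "(\<Sum>k<K. K * card (community Z k)) < (\<Sum>k<K. n)"
      using K by (intro sum_strict_mono) auto
    then show False by (simp add: sum_distrib_left[symmetric] total[symmetric])
  qed
qed

text \<open>
  In a balanced labelling, some class has at most \<open>n / K\<close> members and some class at least \<open>n / K\<close>.
  As sizes are integers, these two sizes enclose the rounded averages, which are the class sizes
  of \<open>label_mat\<close>. So the labellings used here are as balanced as any element of a nonempty
  parameter space.
\<close>
lemma balanced_label_mat:
  assumes K: "0 < K" and S: "S \<subseteq> paired K n"
    and Z: "Z \<in> membership_mats n K" and bal: "balanced \<alpha> n K Z"
  shows "balanced \<alpha> n K (label_mat n K S)"
  unfolding balanced_def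
proof (intro allI impI)
  fix k assume k: "k < K"
  let ?c = "card (community (label_mat n K S) k)"
  have c: "?c = card {i. i < n \<and> i mod K = k}"
    using community_label_mat[OF k] card_label_class[OF S] by simp
  obtain l where l: "l < K" "K * card (community Z l) \<le> n"
    using community_sizes_around_average[OF Z K] by auto
  obtain u where u: "u < K" "n \<le> K * card (community Z u)"
    using community_sizes_around_average[OF Z K] by auto
  have "card (community Z l) \<le> n div K"
    using l(2) K by (simp add: less_eq_div_iff_mult_less_eq mult.commute)
  also have "\<dots> \<le> ?c" using card_residue_class(1)[OF k] c by simp
  finally have "real (card (community Z l)) \<le> real ?c" by simp
  moreover have "?c \<le> card (community Z u)"
  proof (cases "K dvd n")
    case True
    then have "?c * K \<le> K * card (community Z u)" using card_residue_class(3)[OF k] c u(2) by simp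
    then show ?thesis using K by simp
  next
    case False
    have "K * (n div K) \<noteq> n" using False by (metis dvd_triv_left)
    moreover have "K * (n div K) \<le> n" by simp
    ultimately have "K * (n div K) < K * card (community Z u)" using u(2) by linarith
    then have "Suc (n div K) \<le> card (community Z u)" by simp
    then show ?thesis using card_residue_class(2)[OF k, of n] c by linarith
  qed
  then have "real ?c \<le> real (card (community Z u))" by simp
  ultimately show "real n / (\<alpha> * real K) \<le> real ?c \<and> real ?c \<le> \<alpha> * real n / real K"
    using bal l(1) u(1) unfolding balanced_def by (meson order_trans)
qed

text \<open>
  If \<open>K < n < 2 * K\<close>, there would be a class with at most one and a class with at least two
  members, and balance would force \<open>\<alpha>\<close> to be at least \<open>sqrt 2\<close>. Two rows per class are what the
  construction needs: one anchor and one free row.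
\<close>
lemma two_rows_per_community:
  assumes Z: "Z \<in> membership_mats n K" and bal: "balanced \<alpha> n K Z"
    and K: "0 < K" "K < n" and \<alpha>: "0 < \<alpha>" "\<alpha> * \<alpha> < 2"
  shows "2 * K \<le> n"
proof (rule ccontr)
  assume less: "\<not> 2 * K \<le> n"
  obtain l where l: "l < K" "K * card (community Z l) \<le> n"
    using community_sizes_around_average[OF Z K(1)] by auto
  obtain u where u: "u < K" "n \<le> K * card (community Z u)"
    using community_sizes_around_average[OF Z K(1)] by auto
  have "K * card (community Z l) < K * 2" using l(2) less by linarith
  then have cl: "card (community Z l) \<le> 1" by simp
  have "K * 1 < K * card (community Z u)" using u(2) K(2) by linarith
  then have cu: "2 \<le> card (community Z u)" by simp
  have "real n / (\<alpha> * real K) \<le> real (card (community Z l))"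
    using bal l(1) by (simp add: balanced_def)
  also have "\<dots> \<le> 1" using cl by simp
  finally have n: "real n \<le> \<alpha> * real K" using \<alpha>(1) K(1) by (simp add: divide_le_eq)
  have "2 \<le> real (card (community Z u))" using cu by simp
  also have "\<dots> \<le> \<alpha> * real n / real K" using bal u(1) by (simp add: balanced_def)
  finally have "2 * real K \<le> \<alpha> * real n" using K(1) by (simp add: le_divide_eq)
  also have "\<dots> \<le> \<alpha> * (\<alpha> * real K)" using n \<alpha>(1) by (intro mult_left_mono) auto
  finally have "2 * real K \<le> (\<alpha> * \<alpha>) * real K" by simp
  then show False using \<alpha>(2) K(1) by simp
qed

lemma misclustering_rate_bounds:
  assumes "0 < n"
  shows "0 \<le> misclustering_rate n K zh z" and "misclustering_rate n K zh z \<le> 1"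
proof -
  obtain \<pi> where eq: "real n * misclustering_rate n K zh z = real (card {i. i < n \<and> zh i \<noteq> \<pi> (z i)})"
    using misclustering_rate_attained[OF assms] by blast
  have "card {i. i < n \<and> zh i \<noteq> \<pi> (z i)} \<le> card {..<n}" by (intro card_mono) auto
  then have "0 \<le> real n * misclustering_rate n K zh z" "real n * misclustering_rate n K zh z \<le> real n * 1"
    unfolding eq by simp_all
  then show "0 \<le> misclustering_rate n K zh z" "misclustering_rate n K zh z \<le> 1"
    using assms by (simp_all add: zero_le_mult_iff)
qed

section \<open>Lower bounds for the minimax risk\<close>

text \<open>
  For real suprema it has to be checked that the risks are bounded, which holds as the
  misclustering rate is at most 1.
\<close>
lemma minimax_risk_geI:
  assumes n1: "0 < n1" and K: "0 < K"
    and risk: "\<And>zh. \<exists>Z\<in>param_space n1 n2 K \<alpha>.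
      b \<le> measure_pmf.expectation (SBiSBM K (fst Z) (snd Z) p q)
            (\<lambda>A. misclustering_rate n1 K (zh A) (partition_fun (fst Z)))"
  shows "b \<le> minimax_risk n1 n2 K \<alpha> p q"
  unfolding minimax_risk_def
proof (rule cINF_greatest)
  have "(\<lambda>_. restrict (\<lambda>_. 0) {..<n1}) \<in> estimators n1 K"
    using K by (auto simp: estimators_def)
  then show "estimators n1 K \<noteq> {}" by blast
next
  fix zh :: "(nat \<times> nat \<Rightarrow> bool) \<Rightarrow> nat \<Rightarrow> nat"
  let ?R = "\<lambda>(Z1, Z2). measure_pmf.expectation (SBiSBM K Z1 Z2 p q)
    (\<lambda>A. misclustering_rate n1 K (zh A) (partition_fun Z1))"
  obtain Z where Z: "Z \<in> param_space n1 n2 K \<alpha>" "b \<le> ?R Z"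
    using risk[of zh] by (auto simp: case_prod_beta)
  have "?R Z' \<le> 1" for Z'
  proof -
    have "integrable (measure_pmf L) (\<lambda>A. misclustering_rate n1 K (zh A) z)" for L z
      by (rule measure_pmf.integrable_const_bound[where B = 1])
        (use misclustering_rate_bounds[OF n1] in auto)
    then show ?thesis
      using misclustering_rate_bounds(2)[OF n1]
      by (auto simp: case_prod_beta intro!: measure_pmf.integral_le_const)
  qed
  then have "bdd_above (?R ` param_space n1 n2 K \<alpha>)" by (intro bdd_aboveI2)
  then show "b \<le> (SUP Z\<in>param_space n1 n2 K \<alpha>. ?R Z)"
    using Z by (intro cSUP_upper2)
qed

lemma exp_le_one_minus:
  fixes x :: real
  assumes "0 \<le> x" "x \<le> 1 / 2"
  shows "exp (- (2 * x)) \<le> 1 - x"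
proof -
  have "x * x \<le> x * (1 / 2)" using assms by (intro mult_left_mono) auto
  then have "- (2 * x) \<le> - x - 2 * x\<^sup>2" by (simp add: power2_eq_square)
  also have "\<dots> \<le> ln (1 - x)" using assms by (rule ln_one_minus_pos_lower_bound)
  finally show ?thesis using assms by (simp add: ln_ge_iff)
qed

text \<open>
  The constants: with \<open>s = n1 div K \<ge> 2\<close> at least \<open>(s div 2) * (K div 2) \<ge> s K / 9 \<ge> 2 n1 / 27\<close>
  rows are free. The affinity is at least \<open>(1 - x) ^ (n2 div K + 1) / 4\<close> with \<open>x \<le> 96 n1 p\<^sup>2 / K\<close>
  and \<open>n2 div K + 1 \<le> 2 n2 / K\<close>, hence at least \<open>exp (- 384 * snr) / 4\<close>. It enters squared,
  divided by 2 for the test and by 4 in Assouad's argument.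
\<close>
lemma minimax_risk_ge:
  assumes sizes: "2 \<le> K" "2 * K \<le> n1" "K \<le> n2"
    and q: "0 \<le> q" "q \<le> p" and p_half: "p \<le> 1 / 2"
    and small: "96 * real n1 * p\<^sup>2 / real K \<le> 1 / 2"
    and ne: "param_space n1 n2 K \<alpha> \<noteq> {}"
  shows "exp (- (768 * snr n1 n2 K p)) / 1728 \<le> minimax_risk n1 n2 K \<alpha> p q"
proof (rule minimax_risk_geI)
  show n1: "0 < n1" "0 < K" using sizes by auto
  interpret paired_design K n1 n2 p q using sizes q p_half by unfold_locales auto
  let ?s = "n1 div K"
  define x where "x = 64 * real (Suc ?s) * p\<^sup>2"
  have s: "2 \<le> ?s" using sizes by (simp add: less_eq_div_iff_mult_less_eq)
  have "real (K * ?s) \<le> real n1" unfolding of_nat_le_iff by simp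
  then have sK: "real ?s \<le> real n1 / real K" using n1 by (simp add: le_divide_eq mult.commute)
  have x0: "0 \<le> x" by (simp add: x_def)
  have "x \<le> 96 * real ?s * p\<^sup>2" unfolding x_def using s by (intro mult_right_mono) auto
  also have "\<dots> \<le> 96 * (real n1 / real K) * p\<^sup>2" using sK by (intro mult_right_mono) auto
  finally have x: "x \<le> 96 * (real n1 / real K) * p\<^sup>2" .
  have "96 * (real n1 / real K) * p\<^sup>2 = 96 * real n1 * p\<^sup>2 / real K" by simp
  then have x_half: "x \<le> 1 / 2" using x small by linarith
  have "1 \<le> n2 div K" using sizes by (simp add: less_eq_div_iff_mult_less_eq)
  then have "real (Suc (n2 div K)) \<le> 2 * real (n2 div K)" by simp
  also have "real (K * (n2 div K)) \<le> real n2" unfolding of_nat_le_iff by simp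
  then have "2 * real (n2 div K) \<le> 2 * (real n2 / real K)" using n1 by (simp add: le_divide_eq mult.commute)
  finally have N: "real (Suc (n2 div K)) \<le> 2 * (real n2 / real K)" .
  define a where "a = (1 - x) ^ Suc (n2 div K) * (1 - p)\<^sup>2"
  have "exp (- (384 * snr n1 n2 K p)) / 4 \<le> a"
  proof -
    have "real (Suc (n2 div K)) * (2 * x) \<le> (2 * (real n2 / real K)) * (2 * (96 * (real n1 / real K) * p\<^sup>2))"
      using N x x0 by (intro mult_mono) auto
    also have "\<dots> = 384 * snr n1 n2 K p" by (simp add: snr_def)
    finally have "exp (- (384 * snr n1 n2 K p)) \<le> exp (real (Suc (n2 div K)) * (- (2 * x)))" by simp
    also have "\<dots> = exp (- (2 * x)) ^ Suc (n2 div K)" by (rule exp_of_nat_mult)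
    also have "\<dots> \<le> (1 - x) ^ Suc (n2 div K)" by (intro power_mono exp_le_one_minus x0 x_half) auto
    finally have "exp (- (384 * snr n1 n2 K p)) \<le> (1 - x) ^ Suc (n2 div K)" .
    moreover have "(1 / 2)\<^sup>2 \<le> (1 - p)\<^sup>2" using p_half by (intro power_mono) auto
    ultimately have "exp (- (384 * snr n1 n2 K p)) * (1 / 2)\<^sup>2 \<le> a"
      unfolding a_def using x_half by (intro mult_mono) auto
    then show ?thesis by (simp add: power2_eq_square)
  qed
  then have "(exp (- (384 * snr n1 n2 K p)) / 4)\<^sup>2 \<le> a\<^sup>2" by (intro power_mono) auto
  then have a: "exp (- (768 * snr n1 n2 K p)) / 16 \<le> a\<^sup>2"
    by (simp add: power_divide exp_double[symmetric])
  have T: "2 / 27 * real n1 \<le> real (card (free_rows K n1))"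
  proof -
    have third: "real m / 3 \<le> real (m div 2)" if "2 \<le> m" for m :: nat
    proof -
      have "m \<le> 3 * (m div 2)" using that by presburger
      then have "real m \<le> real (3 * (m div 2))" by (rule of_nat_mono)
      then show ?thesis by simp
    qed
    have "n1 < K * Suc ?s" using n1 by (simp add: dividend_less_times_div)
    then have "real n1 \<le> real K * (real ?s + 1)" by (metis of_nat_Suc of_nat_mult of_nat_le_iff less_imp_le add.commute)
    also have "\<dots> \<le> real K * (real ?s * (3 / 2))" using s by (intro mult_left_mono) auto
    finally have "2 / 27 * real n1 \<le> (real ?s / 3) * (real K / 3)" by (simp add: mult_ac)
    also have "\<dots> \<le> real (?s div 2) * real (K div 2)"
      using third[OF s] third[OF sizes(1)] by (intro mult_mono) auto
    also have "\<dots> \<le> real (card (free_rows K n1))"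
      using card_free_rows[of n1 K] by (metis of_nat_mult of_nat_le_iff)
    finally show ?thesis .
  qed
  fix zh :: "(nat \<times> nat \<Rightarrow> bool) \<Rightarrow> nat \<Rightarrow> nat"
  obtain S D where SD: "S \<subseteq> paired K n1" "D \<subseteq> paired K n2"
    and hard: "real (card (free_rows K n1)) * (a\<^sup>2 / 2) / 4
      \<le> (\<Sum>X\<in>Pow ({..<n1} \<times> {..<n2}). bernoulli_weight (edge_prob S D) ({..<n1} \<times> {..<n2}) X
          * (real n1 * misclustering_rate n1 K (zh (\<lambda>e. e \<in> X)) (label K S)))"
    using exists_hard_pair[of zh] n1 x_half unfolding a_def x_def by auto
  let ?Z = "(label_mat n1 K S, label_mat n2 K D)"
  have Z: "?Z \<in> param_space n1 n2 K \<alpha>"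
    using ne n1 SD label_mat_membership balanced_label_mat unfolding param_space_def by blast
  let ?r = "measure_pmf.expectation (SBiSBM K (fst ?Z) (snd ?Z) p q)
    (\<lambda>A. misclustering_rate n1 K (zh A) (partition_fun (fst ?Z)))"
  have r: "?r = (\<Sum>X\<in>Pow ({..<n1} \<times> {..<n2}). bernoulli_weight (edge_prob S D) ({..<n1} \<times> {..<n2}) X
          * misclustering_rate n1 K (zh (\<lambda>e. e \<in> X)) (label K S))"
    unfolding fst_conv snd_conv by (simp add: expectation_SBiSBM misclustering_rate_label_mat n1)
  have "real n1 * (exp (- (768 * snr n1 n2 K p)) / 1728)
      = (2 / 27 * real n1) * (exp (- (768 * snr n1 n2 K p)) / 16 / 8)" by simp
  also have "\<dots> \<le> real (card (free_rows K n1)) * (a\<^sup>2 / 8)"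
    using T a by (intro mult_mono) auto
  also have "\<dots> \<le> real n1 * ?r" using hard unfolding r by (simp add: sum_distrib_left mult_ac)
  finally have "exp (- (768 * snr n1 n2 K p)) / 1728 \<le> ?r" using n1 by simp
  then show "\<exists>Z\<in>param_space n1 n2 K \<alpha>. exp (- (768 * snr n1 n2 K p)) / 1728
      \<le> measure_pmf.expectation (SBiSBM K (fst Z) (snd Z) p q)
            (\<lambda>A. misclustering_rate n1 K (zh A) (partition_fun (fst Z)))"
    using Z by blast
qed

text \<open>
  If \<open>snr \<le> B * ln n1\<close> and \<open>n2 \<ge> R * n1 * ln n1\<close>, then \<open>n1 p\<^sup>2 / K = K * snr / n2 \<le> B / R\<close>,
  because \<open>K \<le> n1\<close>; and \<open>p\<^sup>2\<close> is smaller still. As \<open>R\<close> may be taken arbitrarily large, all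
  smallness conditions of the bound at fixed sizes hold eventually.
\<close>
lemma eventually_minimax_risk_ge:
  assumes regime: "sbisbm_regime c n1 n2 K \<alpha> p" and B: "0 < B"
    and snr_le: "\<forall>\<^sub>F m in sequentially. snr (n1 m) (n2 m) (K m) (p m) \<le> B * ln (real (n1 m))"
  shows "\<forall>\<^sub>F m in sequentially. exp (- (768 * snr (n1 m) (n2 m) (K m) (p m))) / 1728
    \<le> minimax_risk (n1 m) (n2 m) (K m) (\<alpha> m) (p m) (c * p m)"
proof -
  have c: "0 < c" "c < 1" and K: "\<And>m. 2 \<le> K m" and p: "\<And>m. 0 < p m" "\<And>m. p m < 1"
    and n1: "filterlim n1 at_top sequentially"
    and n2: "filterlim (\<lambda>m. real (n2 m) / (real (n1 m) * ln (real (n1 m)))) at_top sequentially"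
    and \<alpha>: "(\<lambda>m. \<alpha> m - 1) \<in> O[sequentially](\<lambda>m. sqrt (ln (real (n1 m)) / real (n1 m)))"
    and ne: "\<forall>\<^sub>F m in sequentially. param_space (n1 m) (n2 m) (K m) (\<alpha> m) \<noteq> {}"
    and Kn: "\<forall>\<^sub>F m in sequentially. K m < n1 m"
    using regime by (auto simp: sbisbm_regime_def)
  obtain A where A: "\<forall>\<^sub>F m in sequentially. norm (\<alpha> m - 1) \<le> A * norm (sqrt (ln (real (n1 m)) / real (n1 m)))"
    using \<alpha> by (rule landau_o.bigE)
  have n1_real: "filterlim (\<lambda>m. real (n1 m)) at_top sequentially"
    by (rule filterlim_compose[OF filterlim_real_sequentially n1])
  have "((\<lambda>m. ln (real (n1 m)) / real (n1 m)) \<longlongrightarrow> 0) sequentially"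
    by (rule filterlim_compose[OF ln_x_over_x_tendsto_0 n1_real])
  then have "((\<lambda>m. sqrt (ln (real (n1 m)) / real (n1 m))) \<longlongrightarrow> sqrt 0) sequentially"
    by (rule tendsto_real_sqrt)
  then have "((\<lambda>m. sqrt (ln (real (n1 m)) / real (n1 m))) \<longlongrightarrow> 0) sequentially" by simp
  then have sqrt0: "((\<lambda>m. A * norm (sqrt (ln (real (n1 m)) / real (n1 m)))) \<longlongrightarrow> 0) sequentially"
    by (intro tendsto_mult_right_zero tendsto_norm_zero)
  have "((\<lambda>m. \<alpha> m - 1) \<longlongrightarrow> 0) sequentially"
    by (rule Lim_null_comparison[OF A sqrt0])
  then have "\<forall>\<^sub>F m in sequentially. dist (\<alpha> m - 1) 0 < 2 / 5"
    by (rule tendstoD) simp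
  moreover have "\<forall>\<^sub>F m in sequentially. 192 * B + 4 * B + 1 \<le> real (n2 m) / (real (n1 m) * ln (real (n1 m)))"
    using n2 by (simp add: filterlim_at_top)
  moreover have "\<forall>\<^sub>F m in sequentially. exp 1 \<le> real (n1 m)"
    using n1_real by (simp add: filterlim_at_top)
  ultimately show ?thesis using ne Kn snr_le
  proof eventually_elim
    case (elim m)
    let ?n1 = "real (n1 m)" and ?n2 = "real (n2 m)" and ?K = "real (K m)" and ?p = "p m"
    have n1_pos: "0 < ?n1" using elim(3) by (smt (verit) exp_gt_zero)
    have ln1: "1 \<le> ln ?n1" using elim(3) n1_pos by (simp add: ln_ge_iff)
    have K0: "0 < ?K" using K[of m] by simp
    have Kn1: "?K \<le> ?n1" using elim(5) by simp
    have pos: "0 < ?n1 * ln ?n1" using n1_pos ln1 by (intro mult_pos_pos) linarith+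
    have "(192 * B + 4 * B + 1) * (?n1 * ln ?n1) \<le> ?n2"
      using elim(2) pos by (simp add: le_divide_eq)
    then have n2_ge: "192 * B * (?n1 * ln ?n1) + 4 * B * (?n1 * ln ?n1) + ?n1 * ln ?n1 \<le> ?n2"
      by (simp add: algebra_simps)
    have "0 \<le> B * (?n1 * ln ?n1)" using B pos by simp
    then have ge1: "192 * B * (?n1 * ln ?n1) \<le> ?n2" and ge2: "4 * B * (?n1 * ln ?n1) \<le> ?n2"
      and ge3: "?n1 * ln ?n1 \<le> ?n2"
      using n2_ge pos by linarith+
    have "?n1 * 1 \<le> ?n1 * ln ?n1" using ln1 n1_pos by (intro mult_left_mono) auto
    then have n12: "?n1 \<le> ?n2" using ge3 by linarith
    have n2_pos: "0 < ?n2" using n12 n1_pos by linarith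
    have key: "?n2 * (?n1 * ?p\<^sup>2 / ?K) \<le> B * (?n1 * ln ?n1)"
    proof -
      have "?n2 * (?n1 * ?p\<^sup>2 / ?K) = ?K * snr (n1 m) (n2 m) (K m) ?p"
        using K0 by (simp add: snr_def field_simps)
      also have "\<dots> \<le> ?K * (B * ln ?n1)" using elim(6) K0 by (intro mult_left_mono) auto
      also have "\<dots> \<le> ?n1 * (B * ln ?n1)" using Kn1 B ln1 by (intro mult_right_mono) auto
      finally show ?thesis by (simp add: mult_ac)
    qed
    have "?n2 * (192 * (?n1 * ?p\<^sup>2 / ?K)) = 192 * (?n2 * (?n1 * ?p\<^sup>2 / ?K))" by simp
    also have "\<dots> \<le> 192 * (B * (?n1 * ln ?n1))" using key by (intro mult_left_mono) auto
    also have "\<dots> \<le> ?n2 * 1" using ge1 by simp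
    finally have "192 * (?n1 * ?p\<^sup>2 / ?K) \<le> 1" using n2_pos by (rule mult_left_le_imp_le)
    then have small: "96 * ?n1 * ?p\<^sup>2 / ?K \<le> 1 / 2" by simp
    have "?n2 * (4 * (?n1 * ?p\<^sup>2 / ?K)) = 4 * (?n2 * (?n1 * ?p\<^sup>2 / ?K))" by simp
    also have "\<dots> \<le> 4 * (B * (?n1 * ln ?n1))" using key by (intro mult_left_mono) auto
    also have "\<dots> \<le> ?n2 * 1" using ge2 by simp
    finally have "4 * (?n1 * ?p\<^sup>2 / ?K) \<le> 1" using n2_pos by (rule mult_left_le_imp_le)
    then have "?n1 * ?p\<^sup>2 / ?K \<le> 1 / 4" by (simp add: mult_ac)
    moreover have "?p\<^sup>2 * ?K \<le> ?p\<^sup>2 * ?n1" using Kn1 by (intro mult_left_mono) auto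
    then have "?p\<^sup>2 \<le> ?n1 * ?p\<^sup>2 / ?K" using K0 by (simp add: le_divide_eq mult.commute)
    ultimately have "?p\<^sup>2 \<le> 1 / 4" by linarith
    then have "?p\<^sup>2 \<le> (1 / 2)\<^sup>2" by (simp add: power_divide)
    then have p_half: "?p \<le> 1 / 2" by (rule power2_le_imp_le) simp
    have "\<bar>\<alpha> m - 1\<bar> < 2 / 5" using elim(1) by (simp only: dist_real_def diff_0_right)
    then have \<alpha>_bounds: "0 < \<alpha> m" "\<alpha> m < 7 / 5" by linarith+
    have "\<alpha> m * \<alpha> m < 7 / 5 * (7 / 5)" using \<alpha>_bounds by (intro mult_strict_mono) auto
    then have \<alpha>2: "\<alpha> m * \<alpha> m < 2" by simp
    have "2 * K m \<le> n1 m"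
      using elim(4,5) two_rows_per_community[OF _ _ _ elim(5) \<alpha>_bounds(1) \<alpha>2] K[of m]
      by (auto simp: param_space_def)
    then show ?case
      using K[of m] elim(4) n12 Kn1 c p(1)[of m] p_half small
      by (intro minimax_risk_ge) auto
  qed
qed

theorem theorem4:
  shows "(\<exists>c\<^sub>1>0. \<forall>c n1 n2 K \<alpha> p.
           sbisbm_regime c n1 n2 K \<alpha> p \<longrightarrow>
           filterlim (\<lambda>m. snr (n1 m) (n2 m) (K m) (p m)) at_top sequentially \<longrightarrow>
           (\<lambda>m. snr (n1 m) (n2 m) (K m) (p m)) \<in> O[sequentially](\<lambda>m. ln (real (n1 m))) \<longrightarrow>
           (\<forall>\<^sub>F m in sequentially.
              minimax_risk (n1 m) (n2 m) (K m) (\<alpha> m) (p m) (c * p m)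
                \<ge> exp (- c\<^sub>1 * snr (n1 m) (n2 m) (K m) (p m))))
    \<and> (\<forall>C>0. \<exists>c\<^sub>2>0. \<forall>c n1 n2 K \<alpha> p.
           sbisbm_regime c n1 n2 K \<alpha> p \<longrightarrow>
           (\<forall>\<^sub>F m in sequentially.
              snr (n1 m) (n2 m) (K m) (p m) \<le> C \<and>
              1 \<le> C * snr (n1 m) (n2 m) (K m) (p m)) \<longrightarrow>
           (\<forall>\<^sub>F m in sequentially.
              minimax_risk (n1 m) (n2 m) (K m) (\<alpha> m) (p m) (c * p m)
                \<ge> c\<^sub>2 / real (K m) ^ 3))"
proof (intro conjI allI impI)
  have ln_ge_1: "\<forall>\<^sub>F m in sequentially. 1 \<le> ln (real (n1 m))"
    if "sbisbm_regime c n1 n2 K \<alpha> p" for c n1 n2 K \<alpha> p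
  proof -
    have "filterlim n1 at_top sequentially" using that by (simp add: sbisbm_regime_def)
    then have "filterlim (\<lambda>m. ln (real (n1 m))) at_top sequentially"
      by (intro filterlim_compose[OF ln_at_top] filterlim_compose[OF filterlim_real_sequentially])
    then show ?thesis by (simp add: filterlim_at_top)
  qed
  show "\<exists>c\<^sub>1>0. \<forall>c n1 n2 K \<alpha> p.
           sbisbm_regime c n1 n2 K \<alpha> p \<longrightarrow>
           filterlim (\<lambda>m. snr (n1 m) (n2 m) (K m) (p m)) at_top sequentially \<longrightarrow>
           (\<lambda>m. snr (n1 m) (n2 m) (K m) (p m)) \<in> O[sequentially](\<lambda>m. ln (real (n1 m))) \<longrightarrow>
           (\<forall>\<^sub>F m in sequentially.
              minimax_risk (n1 m) (n2 m) (K m) (\<alpha> m) (p m) (c * p m)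
                \<ge> exp (- c\<^sub>1 * snr (n1 m) (n2 m) (K m) (p m)))"
  proof (intro exI[of _ 769] conjI allI impI)
    fix c n1 n2 K \<alpha> p
    assume regime: "sbisbm_regime c n1 n2 K \<alpha> p"
      and inf: "filterlim (\<lambda>m. snr (n1 m) (n2 m) (K m) (p m)) at_top sequentially"
      and O: "(\<lambda>m. snr (n1 m) (n2 m) (K m) (p m)) \<in> O[sequentially](\<lambda>m. ln (real (n1 m)))"
    obtain B where B: "0 < B"
      and le: "\<forall>\<^sub>F m in sequentially. norm (snr (n1 m) (n2 m) (K m) (p m)) \<le> B * norm (ln (real (n1 m)))"
      using O by (rule landau_o.bigE)
    have "\<forall>\<^sub>F m in sequentially. snr (n1 m) (n2 m) (K m) (p m) \<le> B * ln (real (n1 m))"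
      using le ln_ge_1[OF regime] by eventually_elim simp
    then have "\<forall>\<^sub>F m in sequentially. exp (- (768 * snr (n1 m) (n2 m) (K m) (p m))) / 1728
        \<le> minimax_risk (n1 m) (n2 m) (K m) (\<alpha> m) (p m) (c * p m)"
      by (rule eventually_minimax_risk_ge[OF regime B])
    moreover have "\<forall>\<^sub>F m in sequentially. ln 1728 \<le> snr (n1 m) (n2 m) (K m) (p m)"
      using inf by (simp add: filterlim_at_top)
    ultimately show "\<forall>\<^sub>F m in sequentially.
        minimax_risk (n1 m) (n2 m) (K m) (\<alpha> m) (p m) (c * p m) \<ge> exp (- 769 * snr (n1 m) (n2 m) (K m) (p m))"
    proof eventually_elim
      case (elim m)
      let ?x = "snr (n1 m) (n2 m) (K m) (p m)"
      have "exp (- 769 * ?x) \<le> exp (- (768 * ?x) - ln 1728)" using elim(2) by simp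
      also have "\<dots> = exp (- (768 * ?x)) / 1728" by (simp add: exp_diff)
      finally show ?case using elim(1) by linarith
    qed
  qed simp
  fix C :: real assume C: "0 < C"
  show "\<exists>c\<^sub>2>0. \<forall>c n1 n2 K \<alpha> p.
           sbisbm_regime c n1 n2 K \<alpha> p \<longrightarrow>
           (\<forall>\<^sub>F m in sequentially.
              snr (n1 m) (n2 m) (K m) (p m) \<le> C \<and>
              1 \<le> C * snr (n1 m) (n2 m) (K m) (p m)) \<longrightarrow>
           (\<forall>\<^sub>F m in sequentially.
              minimax_risk (n1 m) (n2 m) (K m) (\<alpha> m) (p m) (c * p m)
                \<ge> c\<^sub>2 / real (K m) ^ 3)"
  proof (intro exI[of _ "exp (- (768 * C)) / 1728"] conjI allI impI)
    fix c n1 n2 K \<alpha> p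
    assume regime: "sbisbm_regime c n1 n2 K \<alpha> p"
      and snr: "\<forall>\<^sub>F m in sequentially. snr (n1 m) (n2 m) (K m) (p m) \<le> C \<and>
        1 \<le> C * snr (n1 m) (n2 m) (K m) (p m)"
    have "\<forall>\<^sub>F m in sequentially. snr (n1 m) (n2 m) (K m) (p m) \<le> C * ln (real (n1 m))"
      using snr ln_ge_1[OF regime]
    proof eventually_elim
      case (elim m)
      have "C * 1 \<le> C * ln (real (n1 m))" using C elim(2) by (intro mult_left_mono) auto
      then show ?case using elim(1) by linarith
    qed
    then have "\<forall>\<^sub>F m in sequentially. exp (- (768 * snr (n1 m) (n2 m) (K m) (p m))) / 1728
        \<le> minimax_risk (n1 m) (n2 m) (K m) (\<alpha> m) (p m) (c * p m)"
      by (rule eventually_minimax_risk_ge[OF regime C])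
    then show "\<forall>\<^sub>F m in sequentially. minimax_risk (n1 m) (n2 m) (K m) (\<alpha> m) (p m) (c * p m)
        \<ge> exp (- (768 * C)) / 1728 / real (K m) ^ 3"
      using snr
    proof eventually_elim
      case (elim m)
      have K2: "2 \<le> K m" using regime by (simp add: sbisbm_regime_def)
      then have "1 \<le> real (K m) ^ 3" by (intro one_le_power) simp
      then have "exp (- (768 * C)) / 1728 / real (K m) ^ 3 \<le> exp (- (768 * C)) / 1728 / 1"
        using K2 by (intro divide_left_mono) auto
      also have "\<dots> \<le> exp (- (768 * snr (n1 m) (n2 m) (K m) (p m))) / 1728" using elim(2) by simp
      finally show ?case using elim(1) by linarith
    qed
  qed simp
qed

end
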